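(* Let $\rho_j^0\in L^1(\mathbb{R}^+)$, $1\le j\le L$, be such that for all $t\in[0,\tau_j]$ $$e^{-t\mu_j}\int_t^{\tau_j}\rho_j^0(s-t)\,ds+\frac{1}{\mu_j}\left(1-e^{-\mu_jt}\right)\left(\mu_jN_j+C_{j+1}\right)<N_j .$$ Assume that for all $j=1,\dots,L-1$ the parameters are such that $$\widetilde{A_j}:=\frac{\mu_jN_je^{-\mu_j\tau_j}-(1-e^{-\mu_j\tau_j})\,C_{j+1}}{\mu_j}>0 .$$ Then the system $$\partial_t\rho_L+\partial_s\rho_L+\mu_L\rho_L=0,\qquad \rho_L(t,s=0)=\mu_LN_L,$$ $$\partial_t\rho_j+\partial_s\rho_j+\mu_j\rho_j+\frac{C_{j+1}}{A_j(t)}\,\mathbb{I}_{s\ge\tau_j}\,\rho_j=0,\qquad \rho_j(t,s=0)=\mu_jN_j+C_{j+1},\qquad 1\le j\le L-1,$$ with initial condition $\rho_j(0,\cdot)=\rho_j^0$, is well posed. Moreover, for $1\le j\le L-1$, $A_j(t)>0$ for all $t\ge0$ and $A_j(t)=\widetilde{A_j}$ for all $t\ge\tau_j$.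
   Context: $L\ge2$ is an integer (number of hierarchical job levels). For $1\le j\le L$, the parameters $N_j>0$ (size of job class $j$), $\mu_j>0$ (turnover rate) and $\tau_j\ge0$ (minimal waiting time before promotion) are given constants, and $\alpha_j\ge1$ are given constants ($\alpha_j-1$ is the ratio of external over internal hires at level $j$). $\rho_j(t,s)$, $t\ge0$, $s\ge0$, is the density of workers in job $j$ at time $t$ with seniority $s$. Notation: $\mathbb{I}$ is the indicator function, $$A_j(t)=\int_{\tau_j}^{+\infty}\rho_j(t,s)\,ds,\qquad C_j:=\sum_{l=j}^{L}\mu_lN_l\prod_{k=j}^{l}\frac{1}{\alpha_k}\quad(1\le j\le L),\qquad C_{L+1}:=0 .$$ Standing assumptions on the initial data: $\rho_j^0(s)>0$ and $\int_0^{+\infty}\rho_j^0(s)\,ds=N_j$. "Well posed" means that there is a unique global-in-time solution with $\rho_j\in C([0,\infty);L^1(\mathbb{R}^+))$ (in the weak sense, equivalently given by integration along characteristics) and $A_j(t)>0$ for $1\le j\le L-1$, so that the equations make sense. *)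

theory Defs
  imports "HOL-Analysis.Analysis"
begin

text \<open>
  Elements of $L^1(\mathbb{R}^+)$ are represented by functions on \<open>real\<close> that are Lebesgue
  integrable on \<open>{0..}\<close>; their values at negative arguments are irrelevant, and
  equality is equality almost everywhere on \<open>{0..}\<close>.
\<close>

definition eq_L1 :: "(real \<Rightarrow> real) \<Rightarrow> (real \<Rightarrow> real) \<Rightarrow> bool" where
  "eq_L1 f g \<longleftrightarrow> (AE s in lebesgue. s \<ge> 0 \<longrightarrow> f s = g s)"

definition continuous_L1 :: "(real \<Rightarrow> real \<Rightarrow> real) \<Rightarrow> bool" where
  "continuous_L1 f \<longleftrightarrow>
     (\<forall>t\<ge>0. set_integrable lebesgue {0..} (f t)) \<and>
     (\<forall>t\<^sub>0\<ge>0. ((\<lambda>t. LINT s:{0..}|lebesgue. \<bar>f t s - f t\<^sub>0 s\<bar>) \<longlongrightarrow> 0) (at t\<^sub>0 within {0..}))"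

text \<open>
  Continuously differentiable, compactly supported test functions on the plane, with partial
  derivatives \<open>\<phi>t\<close>, \<open>\<phi>s\<close>. They are not required to vanish on the
  boundary of the quadrant \<open>t \<ge> 0\<close>, \<open>s \<ge> 0\<close>.
\<close>

definition test_function ::
    "(real \<times> real \<Rightarrow> real) \<Rightarrow> (real \<times> real \<Rightarrow> real) \<Rightarrow> (real \<times> real \<Rightarrow> real) \<Rightarrow> bool" where
  "test_function \<phi> \<phi>t \<phi>s \<longleftrightarrow>
     (\<forall>p. (\<phi> has_derivative (\<lambda>h. \<phi>t p * fst h + \<phi>s p * snd h)) (at p)) \<and>
     continuous_on UNIV \<phi>t \<and> continuous_on UNIV \<phi>s \<and>
     (\<exists>K. compact K \<and> (\<forall>p. p \<notin> K \<longrightarrow> \<phi> p = 0))"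

text \<open>
  Weak solutions in $C([0,\infty);L^1(\mathbb{R}^+))$ of
  $\partial_t f + \partial_s f + r(t,s) f = 0$, $f(t,0) = b$, $f(0,\cdot) = f_0$: multiply
  by a test function and integrate by parts over the quadrant. For \<open>f\<close> continuous
  into $L^1$, the rates \<open>r\<close> used below make all integrands integrable, so that the
  convention that the integral of a non-integrable function is \<open>0\<close> plays no role.
\<close>

definition weak_solution ::
    "(real \<Rightarrow> real \<Rightarrow> real) \<Rightarrow> real \<Rightarrow> (real \<Rightarrow> real) \<Rightarrow> (real \<Rightarrow> real \<Rightarrow> real) \<Rightarrow> bool" where
  "weak_solution r b f\<^sub>0 f \<longleftrightarrow>
     continuous_L1 f \<and>
     eq_L1 (f 0) f\<^sub>0 \<and>
     (\<forall>\<phi> \<phi>t \<phi>s. test_function \<phi> \<phi>t \<phi>s \<longrightarrow>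
        (LINT t:{0..}|lebesgue. (LINT s:{0..}|lebesgue.
            f t s * (\<phi>t (t, s) + \<phi>s (t, s) - r t s * \<phi> (t, s))))
        + (LINT s:{0..}|lebesgue. f\<^sub>0 s * \<phi> (0, s))
        + (LINT t:{0..}|lebesgue. b * \<phi> (t, 0)) = 0)"

text \<open>
  For \<open>j = L + 1\<close> the sum is empty, which gives the convention $C_{L+1} = 0$.
\<close>

definition C_const :: "nat \<Rightarrow> (nat \<Rightarrow> real) \<Rightarrow> (nat \<Rightarrow> real) \<Rightarrow> (nat \<Rightarrow> real) \<Rightarrow> nat \<Rightarrow> real" where
  "C_const L N \<mu> \<alpha> j = (\<Sum>l=j..L. \<mu> l * N l * (\<Prod>k=j..l. 1 / \<alpha> k))"

definition A_fun :: "(nat \<Rightarrow> real) \<Rightarrow> (nat \<Rightarrow> real \<Rightarrow> real \<Rightarrow> real) \<Rightarrow> nat \<Rightarrow> real \<Rightarrow> real" where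
  "A_fun \<tau> \<rho> j t = (LINT s:{\<tau> j..}|lebesgue. \<rho> j t s)"

definition A_tilde ::
    "nat \<Rightarrow> (nat \<Rightarrow> real) \<Rightarrow> (nat \<Rightarrow> real) \<Rightarrow> (nat \<Rightarrow> real) \<Rightarrow> (nat \<Rightarrow> real) \<Rightarrow> nat \<Rightarrow> real" where
  "A_tilde L N \<mu> \<tau> \<alpha> j =
     (\<mu> j * N j * exp (- \<mu> j * \<tau> j) - (1 - exp (- \<mu> j * \<tau> j)) * C_const L N \<mu> \<alpha> (j + 1)) / \<mu> j"

text \<open>
  Global solutions of the system. Only \<open>\<rho> j t s\<close> with \<open>1 \<le> j \<le> L\<close>,
  \<open>t \<ge> 0\<close>, \<open>s \<ge> 0\<close> matters. Positivity of $A_j$ is part of the notion of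
  solution, since otherwise the promotion rate $C_{j+1}/A_j(t)$ makes no sense.
\<close>

definition system_solution ::
    "nat \<Rightarrow> (nat \<Rightarrow> real) \<Rightarrow> (nat \<Rightarrow> real) \<Rightarrow> (nat \<Rightarrow> real) \<Rightarrow> (nat \<Rightarrow> real) \<Rightarrow>
     (nat \<Rightarrow> real \<Rightarrow> real) \<Rightarrow> (nat \<Rightarrow> real \<Rightarrow> real \<Rightarrow> real) \<Rightarrow> bool" where
  "system_solution L N \<mu> \<tau> \<alpha> \<rho>\<^sub>0 \<rho> \<longleftrightarrow>
     weak_solution (\<lambda>t s. \<mu> L) (\<mu> L * N L) (\<rho>\<^sub>0 L) (\<rho> L) \<and>
     (\<forall>j\<in>{1..L-1}.
        (\<forall>t\<ge>0. A_fun \<tau> \<rho> j t > 0) \<and>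
        weak_solution
          (\<lambda>t s. \<mu> j + C_const L N \<mu> \<alpha> (j + 1) / A_fun \<tau> \<rho> j t * indicator {\<tau> j..} s)
          (\<mu> j * N j + C_const L N \<mu> \<alpha> (j + 1)) (\<rho>\<^sub>0 j) (\<rho> j))"

definition well_posed ::
    "nat \<Rightarrow> (nat \<Rightarrow> real) \<Rightarrow> (nat \<Rightarrow> real) \<Rightarrow> (nat \<Rightarrow> real) \<Rightarrow> (nat \<Rightarrow> real) \<Rightarrow>
     (nat \<Rightarrow> real \<Rightarrow> real) \<Rightarrow> bool" where
  "well_posed L N \<mu> \<tau> \<alpha> \<rho>\<^sub>0 \<longleftrightarrow>
     (\<exists>\<rho>. system_solution L N \<mu> \<tau> \<alpha> \<rho>\<^sub>0 \<rho>) \<and>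
     (\<forall>\<rho> \<rho>'. system_solution L N \<mu> \<tau> \<alpha> \<rho>\<^sub>0 \<rho> \<longrightarrow> system_solution L N \<mu> \<tau> \<alpha> \<rho>\<^sub>0 \<rho>' \<longrightarrow>
        (\<forall>j\<in>{1..L}. \<forall>t\<ge>0. eq_L1 (\<rho> j t) (\<rho>' j t)))"

end

theory Submission
  imports Defs
begin

text \<open>
  Testing with functions of \<open>s - t\<close> shows that along characteristics a weak solution satisfies
  an integral equation in \<open>t\<close>. Below the threshold \<open>\<tau>\<close> this equation does not involve the promotion
  rate, so the mass below the threshold is explicit; integrating over all seniorities, the promoted flux
  \<open>(C / A) A = C\<close> is constant, so the total mass stays equal to \<open>N\<close>. Hence \<open>A\<close> is determined a priori,
  and the nonlinear problem reduces to a linear one with a known continuous rate. That problem is solved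
  by integration along characteristics, and uniqueness follows from the same integral equations,
  first below and then above the threshold.
\<close>

subsection \<open>Pairing along characteristics\<close>

text \<open>Duality would be a natural route to uniqueness, but the rate jumps at
  \<open>s = \<tau>\<close>, so solutions of the dual problem are in general not C1 and cannot serve
  as test functions. Functions of \<open>s - t\<close> avoid this: the transport operator
  annihilates them, the rate stays on the right-hand side, and each profile \<open>g\<close> leaves
  a scalar linear equation for \<open>transport_pairing f 0 g\<close>. The useful profiles are the
  indicator of \<open>{..c}\<close>, whose pairing at time \<open>t\<close> is the mass in
  \<open>{0..c+t}\<close> behind one characteristic, and the constant 1. Neither is C1 with compact
  support, hence the cutoffs and the passages to the limit.

  The two inequalities assumed of the data say that the predicted eligible mass is positive, one up
  to time \<open>\<tau>\<close> and one from then on. They make \<open>C / eligible\<close> a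
  legitimate rate before any solution is known. A solution for this frozen rate solves the coupled
  system once its total mass is known to be \<open>N\<close>; the deviation from \<open>N\<close>
  satisfies a homogeneous linear equation with zero initial value.\<close>

lemma set_integral_dominated_convergence:
  fixes u :: "nat \<Rightarrow> 'a \<Rightarrow> real"
  assumes "set_integrable M S w" "\<And>n. set_integrable M S (u n)" "set_integrable M S v"
    and "AE x in M. x \<in> S \<longrightarrow> (\<lambda>n. u n x) \<longlonglongrightarrow> v x"
    and "\<And>n x. x \<in> S \<Longrightarrow> \<bar>u n x\<bar> \<le> w x"
  shows "(\<lambda>n. LINT x:S|M. u n x) \<longlonglongrightarrow> (LINT x:S|M. v x)"
  unfolding set_lebesgue_integral_def
proof (rule integral_dominated_convergence)
  show "(\<lambda>x. indicator S x *\<^sub>R v x) \<in> borel_measurable M" "integrable M (\<lambda>x. indicator S x *\<^sub>R w x)"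
    "\<And>i. (\<lambda>x. indicator S x *\<^sub>R u i x) \<in> borel_measurable M"
    using assms(1-3) by (auto simp: set_integrable_def)
  show "AE x in M. (\<lambda>n. indicator S x *\<^sub>R u n x) \<longlonglongrightarrow> indicator S x *\<^sub>R v x"
    using assms(4) by eventually_elim (auto split: split_indicator)
  show "\<And>i. AE x in M. norm (indicator S x *\<^sub>R u i x) \<le> indicator S x *\<^sub>R w x"
    using assms(5) by (intro AE_I2) (simp split: split_indicator)
qed

lemma set_integral_abs_bound:
  fixes f :: "'a \<Rightarrow> real"
  assumes "set_integrable M S f" "set_integrable M S w" "\<And>x. x \<in> S \<Longrightarrow> \<bar>f x\<bar> \<le> w x"
  shows "\<bar>LINT x:S|M. f x\<bar> \<le> (LINT x:S|M. w x)"
proof -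
  have "norm (LINT x|M. indicator S x *\<^sub>R f x) \<le> (LINT x|M. norm (indicator S x *\<^sub>R f x))"
    by (rule integral_norm_bound)
  also have "\<dots> \<le> (LINT x|M. indicator S x *\<^sub>R w x)"
    by (rule integral_mono[OF integrable_norm]) 
       (use assms in \<open>simp_all add: set_integrable_def split: split_indicator\<close>)
  finally show ?thesis by (simp add: set_lebesgue_integral_def)
qed

lemma abs_mult_le_bound:
  fixes x y :: real
  shows "\<bar>y\<bar> \<le> B \<Longrightarrow> \<bar>x * y\<bar> \<le> B * \<bar>x\<bar>"
  by (metis abs_ge_zero abs_mult mult.commute mult_right_mono)

lemma absolutely_integrable_times_bounded_borel:
  fixes f g :: "real \<Rightarrow> real"
  assumes f: "f absolutely_integrable_on S" and S: "S \<in> sets lebesgue"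
    and g: "g \<in> borel_measurable lebesgue" and b: "\<And>x. \<bar>g x\<bar> \<le> B"
  shows "(\<lambda>s. f s * g s) absolutely_integrable_on S"
proof (rule set_integrable_bound[where f="\<lambda>s. B * f s"])
  show "(\<lambda>s. B * f s) absolutely_integrable_on S" using f by (rule set_integrable_mult_right)
  have "(\<lambda>x. (indicator S x *\<^sub>R f x) * g x) \<in> borel_measurable lebesgue"
    using borel_measurable_integrable[OF f[unfolded set_integrable_def]] g by (rule borel_measurable_times)
  then show "set_borel_measurable lebesgue S (\<lambda>s. f s * g s)"
    by (simp add: set_borel_measurable_def mult.assoc)
  have "norm (f x * g x) \<le> norm (B * f x)" for x
    using abs_mult_le_bound[OF b[of x], of "f x"] b[of 0] by (simp add: abs_mult)
  then show "AE x in lebesgue. x \<in> S \<longrightarrow> norm (f x * g x) \<le> norm (B * f x)"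
    by simp
qed

text \<open>Profiles are kept Borel: composition with a translation or a reflection then stays
  Borel, and completion turns this into Lebesgue measurability.\<close>

lemma shift_measurable_lebesgue:
  fixes g :: "real \<Rightarrow> real"
  assumes "g \<in> borel_measurable borel"
  shows "(\<lambda>s. g (s - t)) \<in> borel_measurable lebesgue" "(\<lambda>s. g (- s)) \<in> borel_measurable lebesgue"
    "g \<in> borel_measurable lebesgue"
  using assms by (auto intro!: measurable_completion)

text \<open>The test function depends on \<open>s - t\<close> only, that is, it is constant along characteristics.\<close>

definition transport_pairing :: "(real \<Rightarrow> real \<Rightarrow> real) \<Rightarrow> real \<Rightarrow> (real \<Rightarrow> real) \<Rightarrow> real \<Rightarrow> real" where
  "transport_pairing f a g t = (LINT s:{a..}|lebesgue. f t s * g (s - t))"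

lemma continuous_L1_integrable:
  "continuous_L1 f \<Longrightarrow> t \<ge> 0 \<Longrightarrow> a \<ge> 0 \<Longrightarrow> f t absolutely_integrable_on {a..}"
  by (auto simp: continuous_L1_def intro: set_integrable_subset[where A="{0..}"])

lemma transport_integrable:
  assumes "continuous_L1 f" "t \<ge> 0" "a \<ge> 0" "g \<in> borel_measurable borel" "\<And>x. \<bar>g x\<bar> \<le> B"
  shows "(\<lambda>s. f t s * g (s - t)) absolutely_integrable_on {a..}"
  by (rule absolutely_integrable_times_bounded_borel[OF continuous_L1_integrable[OF assms(1-3)] _
        shift_measurable_lebesgue(1)[OF assms(4)] assms(5)]) simp

text \<open>Only the sup bound of the profile enters. On compact time intervals the right-hand side
  is bounded, which gives the constant that dominates the sources when profiles converge.\<close>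

lemma transport_pairing_bound:
  assumes f: "continuous_L1 f" "t \<ge> 0" "a \<ge> 0" "g \<in> borel_measurable borel" "\<And>x. \<bar>g x\<bar> \<le> B"
  shows "\<bar>transport_pairing f a g t\<bar> \<le> B * (LINT s:{0..}|lebesgue. \<bar>f t s\<bar>)"
proof -
  have B: "B \<ge> 0" using assms(5)[of 0] by linarith
  have i: "(\<lambda>s. \<bar>f t s\<bar>) absolutely_integrable_on {b..}" if "b \<ge> 0" for b
    using continuous_L1_integrable[OF f(1,2) that] by (rule set_integrable_abs)
  have "\<bar>transport_pairing f a g t\<bar> \<le> (LINT s:{a..}|lebesgue. B * \<bar>f t s\<bar>)"
    unfolding transport_pairing_def
  proof (rule set_integral_abs_bound[OF transport_integrable[OF assms]])
    show "(\<lambda>s. B * \<bar>f t s\<bar>) absolutely_integrable_on {a..}"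
      using i[OF f(3)] by (rule set_integrable_mult_right)
  qed (rule abs_mult_le_bound[OF f(5)])
  also have "\<dots> = B * (LINT s:{a..}|lebesgue. \<bar>f t s\<bar>)" by simp
  also have "\<dots> \<le> B * (LINT s:{0..}|lebesgue. \<bar>f t s\<bar>)"
    using B i[OF order.refl] i[OF f(3)] f(3)
    by (intro mult_left_mono)
       (auto simp: set_lebesgue_integral_def set_integrable_def intro!: integral_mono split: split_indicator)
  finally show ?thesis .
qed

lemma continuous_L1_tendsto:
  assumes "continuous_L1 f" "t0 \<ge> 0"
  shows "((\<lambda>t. LINT s:{0..}|lebesgue. \<bar>f t s - f t0 s\<bar>) \<longlongrightarrow> 0) (at t0 within {0..})"
  using assms unfolding continuous_L1_def by blast

lemma continuous_L1_norm:
  assumes f: "continuous_L1 f"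
  shows "continuous_on {0..} (\<lambda>t. LINT s:{0..}|lebesgue. \<bar>f t s\<bar>)"
  unfolding continuous_on_def
proof (intro ballI)
  fix t0 :: real assume t0: "t0 \<in> {0..}"
  have "((\<lambda>t. (LINT s:{0..}|lebesgue. \<bar>f t s\<bar>) - (LINT s:{0..}|lebesgue. \<bar>f t0 s\<bar>)) \<longlongrightarrow> 0) (at t0 within {0..})"
  proof (rule Lim_null_comparison)
    show "((\<lambda>t. LINT s:{0..}|lebesgue. \<bar>f t s - f t0 s\<bar>) \<longlongrightarrow> 0) (at t0 within {0..})"
      using t0 by (intro continuous_L1_tendsto f) simp
    show "\<forall>\<^sub>F t in at t0 within {0..}. norm ((LINT s:{0..}|lebesgue. \<bar>f t s\<bar>) - (LINT s:{0..}|lebesgue. \<bar>f t0 s\<bar>))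
        \<le> (LINT s:{0..}|lebesgue. \<bar>f t s - f t0 s\<bar>)"
      unfolding eventually_at_filter
    proof (intro always_eventually allI impI)
      fix t :: real assume "t \<in> {0..}"
      then have i: "f t absolutely_integrable_on {0..}" "f t0 absolutely_integrable_on {0..}"
        using t0 by (simp_all add: continuous_L1_integrable[OF f])
      note ia = set_integrable_abs[OF i(1)] set_integrable_abs[OF i(2)]
      have "norm (LINT s:{0..}|lebesgue. \<bar>f t s\<bar> - \<bar>f t0 s\<bar>) \<le> (LINT s:{0..}|lebesgue. \<bar>f t s - f t0 s\<bar>)"
        unfolding real_norm_def
        by (rule set_integral_abs_bound[OF set_integral_diff(1)[OF ia] set_integrable_abs[OF set_integral_diff(1)[OF i]]])
           linarith
      then show "norm ((LINT s:{0..}|lebesgue. \<bar>f t s\<bar>) - (LINT s:{0..}|lebesgue. \<bar>f t0 s\<bar>))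
        \<le> (LINT s:{0..}|lebesgue. \<bar>f t s - f t0 s\<bar>)"
        unfolding set_integral_diff(2)[OF ia] .
    qed
  qed
  then show "((\<lambda>t. LINT s:{0..}|lebesgue. \<bar>f t s\<bar>) \<longlongrightarrow> (LINT s:{0..}|lebesgue. \<bar>f t0 s\<bar>)) (at t0 within {0..})"
    by (rule LIM_zero_cancel)
qed

lemma continuous_L1_norm_bounded:
  assumes "continuous_L1 f"
  obtains B where "B \<ge> 0" "\<And>t. t \<in> {0..T} \<Longrightarrow> (LINT s:{0..}|lebesgue. \<bar>f t s\<bar>) \<le> B"
proof -
  have "continuous_on {0..T} (\<lambda>t. LINT s:{0..}|lebesgue. \<bar>f t s\<bar>)"
    by (rule continuous_on_subset[OF continuous_L1_norm[OF assms]]) auto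
  then have "compact ((\<lambda>t. LINT s:{0..}|lebesgue. \<bar>f t s\<bar>) ` {0..T})"
    by (intro compact_continuous_image) auto
  then obtain B where "\<And>t. t \<in> {0..T} \<Longrightarrow> \<bar>LINT s:{0..}|lebesgue. \<bar>f t s\<bar>\<bar> \<le> B"
    by (metis bounded_iff compact_imp_bounded image_eqI real_norm_def)
  then show ?thesis by (intro that[of "max 0 B"]) (auto simp: max_def; fastforce)+
qed

text \<open>Both pairings use the same shift \<open>r\<close>, which need not be either of the two
  times. This separates the dependence on the density from that on the moving profile.\<close>

lemma transport_pairing_diff_bound:
  assumes f: "continuous_L1 f" "continuous_L1 f'" "t \<ge> 0" "t' \<ge> 0" "a \<ge> 0"
    and g: "g \<in> borel_measurable borel" "\<And>x. \<bar>g x\<bar> \<le> B"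
  shows "\<bar>(LINT s:{a..}|lebesgue. f t s * g (s - r)) - (LINT s:{a..}|lebesgue. f' t' s * g (s - r))\<bar>
     \<le> B * (LINT s:{0..}|lebesgue. \<bar>f t s - f' t' s\<bar>)"
proof -
  have B: "B \<ge> 0" using g(2)[of 0] by linarith
  have i: "f t absolutely_integrable_on {b..}" "f' t' absolutely_integrable_on {b..}" if "b \<ge> 0" for b
    using continuous_L1_integrable[OF f(1,3) that] continuous_L1_integrable[OF f(2,4) that] by auto
  have d: "(\<lambda>s. \<bar>f t s - f' t' s\<bar>) absolutely_integrable_on {b..}" if "b \<ge> 0" for b
    using i[OF that] by (intro set_integrable_abs set_integral_diff)
  have p: "(\<lambda>s. f t s * g (s - r)) absolutely_integrable_on {a..}" "(\<lambda>s. f' t' s * g (s - r)) absolutely_integrable_on {a..}"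
    by (rule absolutely_integrable_times_bounded_borel[where B=B], rule i[OF f(5)], simp,
        rule shift_measurable_lebesgue[OF g(1)], rule g(2))+
  have "\<bar>(LINT s:{a..}|lebesgue. f t s * g (s - r)) - (LINT s:{a..}|lebesgue. f' t' s * g (s - r))\<bar>
    = \<bar>LINT s:{a..}|lebesgue. f t s * g (s - r) - f' t' s * g (s - r)\<bar>"
    using p by (subst set_integral_diff(2)) auto
  also have "\<dots> \<le> (LINT s:{a..}|lebesgue. B * \<bar>f t s - f' t' s\<bar>)"
  proof (rule set_integral_abs_bound[OF set_integral_diff(1)[OF p]])
    show "(\<lambda>s. B * \<bar>f t s - f' t' s\<bar>) absolutely_integrable_on {a..}"
      using d[OF f(5)] by (rule set_integrable_mult_right)
    show "\<bar>f t s * g (s - r) - f' t' s * g (s - r)\<bar> \<le> B * \<bar>f t s - f' t' s\<bar>" for s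
      using abs_mult_le_bound[OF g(2), of "f t s - f' t' s" "s - r"] by (simp add: left_diff_distrib)
  qed
  also have "\<dots> = B * (LINT s:{a..}|lebesgue. \<bar>f t s - f' t' s\<bar>)" by simp
  also have "\<dots> \<le> B * (LINT s:{0..}|lebesgue. \<bar>f t s - f' t' s\<bar>)"
    using B d[OF order.refl] d[OF f(5)] f(5)
    by (intro mult_left_mono)
       (auto simp: set_lebesgue_integral_def set_integrable_def intro!: integral_mono split: split_indicator)
  finally show ?thesis .
qed

lemma AE_shift_notin_finite:
  fixes t :: real
  assumes "finite D"
  shows "AE s in lebesgue. s - t \<notin> D"
proof -
  have "AE s in lebesgue. s \<notin> (+) t ` D"
    using assms by (intro AE_not_in) (auto simp: negligible_iff_null_sets[symmetric] negligible_finite)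
  then show ?thesis by eventually_elim (force simp: image_iff)
qed

text \<open>The increment splits into a change of density under a common profile, controlled by the
  L1 distance, and a motion of the profile over a fixed density, handled by dominated convergence.
  Finitely many jumps of \<open>g\<close> are harmless because at each time their translates form a
  null set.\<close>

lemma transport_pairing_continuous:
  assumes f: "continuous_L1 f" and a: "a \<ge> 0"
    and g: "g \<in> borel_measurable borel" "\<And>x. \<bar>g x\<bar> \<le> B" "finite D" "\<And>x. x \<notin> D \<Longrightarrow> isCont g x"
  shows "continuous_on {0..} (transport_pairing f a g)"
  unfolding continuous_on_sequentially
proof (intro ballI allI impI, elim conjE)
  fix x :: "nat \<Rightarrow> real" and t :: real
  assume x: "\<forall>n. x n \<in> {0..}" and t: "t \<in> {0..}" and lim: "x \<longlonglongrightarrow> t"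
  let ?P = "\<lambda>n. LINT s:{a..}|lebesgue. f t s * g (s - x n)"
  have fi: "f t absolutely_integrable_on {a..}" using continuous_L1_integrable[OF f _ a] t by auto
  have p: "(\<lambda>s. f t s * g (s - r)) absolutely_integrable_on {a..}" for r
    by (rule absolutely_integrable_times_bounded_borel[OF fi _ shift_measurable_lebesgue(1)[OF g(1)] g(2)]) simp
  have 1: "?P \<longlonglongrightarrow> transport_pairing f a g t"
    unfolding transport_pairing_def
  proof (rule set_integral_dominated_convergence[where w="\<lambda>s. B * \<bar>f t s\<bar>"])
    show "(\<lambda>s. B * \<bar>f t s\<bar>) absolutely_integrable_on {a..}"
      using fi by (intro set_integrable_mult_right set_integrable_abs)
    show "AE s in lebesgue. s \<in> {a..} \<longrightarrow> (\<lambda>n. f t s * g (s - x n)) \<longlonglongrightarrow> f t s * g (s - t)"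
      using AE_shift_notin_finite[OF g(3), of t]
    proof eventually_elim
      case (elim s)
      have "(\<lambda>n. s - x n) \<longlonglongrightarrow> s - t" using lim by (intro tendsto_intros)
      from isCont_tendsto_compose[OF g(4)[OF elim] this] show ?case by (auto intro!: tendsto_intros)
    qed
  qed (rule p | rule abs_mult_le_bound[OF g(2)])+
  have tend: "((\<lambda>t'. LINT s:{0..}|lebesgue. \<bar>f t' s - f t s\<bar>) \<longlongrightarrow> 0) (at t within {0..})"
    using t by (intro continuous_L1_tendsto f) simp
  have cnt: "continuous (at t within {0..}) (\<lambda>t'. LINT s:{0..}|lebesgue. \<bar>f t' s - f t s\<bar>)"
    using tend by (simp add: continuous_within)
  have d: "(\<lambda>n. LINT s:{0..}|lebesgue. \<bar>f (x n) s - f t s\<bar>) \<longlonglongrightarrow> 0"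
    using continuous_within_tendsto_compose'[OF cnt _ lim] x by simp
  have 2: "(\<lambda>n. transport_pairing f a g (x n) - ?P n) \<longlonglongrightarrow> 0"
  proof (rule Lim_null_comparison)
    show "\<forall>\<^sub>F n in sequentially. norm (transport_pairing f a g (x n) - ?P n)
        \<le> B * (LINT s:{0..}|lebesgue. \<bar>f (x n) s - f t s\<bar>)"
      unfolding transport_pairing_def real_norm_def
      by (intro always_eventually allI transport_pairing_diff_bound f a g) (use x t in auto)
    show "(\<lambda>n. B * (LINT s:{0..}|lebesgue. \<bar>f (x n) s - f t s\<bar>)) \<longlonglongrightarrow> 0"
      using tendsto_mult_left[OF d, of B] by simp
  qed
  show "(transport_pairing f a g \<circ> x) \<longlonglongrightarrow> transport_pairing f a g t"
    using tendsto_add[OF 2 1] by (simp add: comp_def)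
qed

subsection \<open>From the weak form to an integral equation\<close>

lemma DERIV_max_0_square:
  "((\<lambda>x::real. (max 0 x)\<^sup>2) has_real_derivative 2 * max 0 x) (at x)"
proof -
  consider "x < 0" | "x > 0" | "x = 0" by linarith
  then show ?thesis
  proof cases
    case 1
    have "((\<lambda>x::real. 0) has_real_derivative 2 * max 0 x) (at x)" using 1 by simp
    then show ?thesis
      by (rule has_field_derivative_transform_within_open[of _ _ _ "{..<0}"]) (use 1 in auto)
  next
    case 2
    have "((\<lambda>x::real. x\<^sup>2) has_real_derivative 2 * max 0 x) (at x)"
      using 2 by (auto intro!: derivative_eq_intros)
    then show ?thesis
      by (rule has_field_derivative_transform_within_open[of _ _ _ "{0<..}"]) (use 2 in auto)
  next
    case 3
    have "((\<lambda>h. (max 0 h)\<^sup>2 / h) \<longlongrightarrow> 0) (at (0::real))"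
    proof (rule Lim_null_comparison[of _ "\<lambda>h. \<bar>h\<bar>"])
      show "\<forall>\<^sub>F h in at 0. norm ((max 0 h)\<^sup>2 / h) \<le> \<bar>h\<bar>" for h :: real
        by (intro always_eventually allI) (auto simp: max_def power2_eq_square)
      show "((\<lambda>h::real. \<bar>h\<bar>) \<longlongrightarrow> 0) (at 0)" by (auto intro!: tendsto_eq_intros)
    qed
    then show ?thesis using 3 by (simp add: DERIV_def)
  qed
qed

text \<open>A transition from 0 to 1 over the unit interval. Test functions are only C1, so squared
  positive parts can replace the usual \<open>exp (- 1 / x)\<close>.\<close>

definition smoothstep :: "real \<Rightarrow> real" where
  "smoothstep x = (max 0 x)\<^sup>2 / ((max 0 x)\<^sup>2 + (max 0 (1 - x))\<^sup>2)"

text \<open>The numerator of the quotient rule in factored form, so that its sign and its vanishing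
  outside the unit interval can be read off.\<close>

definition smoothstep_deriv :: "real \<Rightarrow> real" where
  "smoothstep_deriv x = 2 * max 0 x * max 0 (1 - x) * (max 0 x + max 0 (1 - x)) / ((max 0 x)\<^sup>2 + (max 0 (1 - x))\<^sup>2)\<^sup>2"

lemma smoothstep_denominator: "(max 0 x)\<^sup>2 + (max 0 (1 - x))\<^sup>2 > (0::real)"
  by (cases "x \<le> 0") (auto simp: max_def add_pos_nonneg add_nonneg_pos)

lemma smoothstep_has_derivative: "(smoothstep has_real_derivative smoothstep_deriv x) (at x)"
proof -
  have q: "((\<lambda>x::real. (max 0 (1 - x))\<^sup>2) has_real_derivative - (2 * max 0 (1 - x))) (at x)"
    by (rule DERIV_cong[OF DERIV_chain2[OF DERIV_max_0_square DERIV_diff[OF DERIV_const DERIV_ident]]]) simp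
  have "(smoothstep has_real_derivative
     (2 * max 0 x * ((max 0 x)\<^sup>2 + (max 0 (1 - x))\<^sup>2) - (max 0 x)\<^sup>2 * (2 * max 0 x + - (2 * max 0 (1 - x)))) /
      (((max 0 x)\<^sup>2 + (max 0 (1 - x))\<^sup>2) * ((max 0 x)\<^sup>2 + (max 0 (1 - x))\<^sup>2))) (at x)"
    unfolding smoothstep_def[abs_def]
    using smoothstep_denominator[of x]
    by (intro DERIV_divide DERIV_add DERIV_max_0_square q) auto
  moreover have "(2 * max 0 x * ((max 0 x)\<^sup>2 + (max 0 (1 - x))\<^sup>2) - (max 0 x)\<^sup>2 * (2 * max 0 x + - (2 * max 0 (1 - x))))
    = 2 * max 0 x * max 0 (1 - x) * (max 0 x + max 0 (1 - x))"
    by (simp add: algebra_simps power2_eq_square)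
  ultimately show ?thesis by (simp only: smoothstep_deriv_def power2_eq_square[of "_ + _"])
qed

lemma smoothstep_deriv_continuous: "continuous_on UNIV smoothstep_deriv"
proof -
  have "((max 0 x)\<^sup>2 + (max 0 (1 - x))\<^sup>2)\<^sup>2 \<noteq> (0::real)" for x
    using smoothstep_denominator[of x] by (metis less_irrefl zero_eq_power2)
  then show ?thesis unfolding smoothstep_deriv_def[abs_def] by (intro continuous_intros ballI)
qed

lemma smoothstep_bounds: "0 \<le> smoothstep x" "smoothstep x \<le> 1"
  using smoothstep_denominator[of x] by (auto simp: smoothstep_def)

lemma smoothstep_values: "x \<le> 0 \<Longrightarrow> smoothstep x = 0" "x \<ge> 1 \<Longrightarrow> smoothstep x = 1"
  by (auto simp: smoothstep_def max_def)

lemma smoothstep_deriv_nonneg: "smoothstep_deriv x \<ge> 0"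
  unfolding smoothstep_deriv_def by (intro divide_nonneg_nonneg mult_nonneg_nonneg) auto

lemma smoothstep_deriv_values: "x \<le> 0 \<Longrightarrow> smoothstep_deriv x = 0" "x \<ge> 1 \<Longrightarrow> smoothstep_deriv x = 0"
  by (auto simp: smoothstep_deriv_def)

definition C1_compact_support :: "(real \<Rightarrow> real) \<Rightarrow> (real \<Rightarrow> real) \<Rightarrow> bool" where
  "C1_compact_support g g' \<longleftrightarrow> (\<forall>x. (g has_real_derivative g' x) (at x)) \<and> continuous_on UNIV g' \<and>
     (\<exists>R. \<forall>x. \<bar>x\<bar> > R \<longrightarrow> g x = 0)"

lemma C1_compact_supportD:
  assumes "C1_compact_support g g'"
  shows "(g has_real_derivative g' x) (at x)" "continuous_on S g'" "continuous_on S g" "isCont g x"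
    "g \<in> borel_measurable borel"
proof -
  show 1: "(g has_real_derivative g' x) (at x)" for x using assms by (simp add: C1_compact_support_def)
  show "continuous_on S g'"
    using assms continuous_on_subset[of UNIV g' S] by (simp add: C1_compact_support_def)
  show 2: "isCont g x" for x using 1 by (rule DERIV_isCont)
  show 3: "continuous_on S g" for S by (simp add: 2 continuous_at_imp_continuous_on)
  show "g \<in> borel_measurable borel" by (rule borel_measurable_continuous_onI[OF 3])
qed

text \<open>The shift by 1 puts both transitions outside \<open>{d..c}\<close>: the product is 1
  there when \<open>d \<le> c\<close>, and it vanishes from \<open>c + 1 / n\<close> on and up to
  \<open>d - 1 / m\<close>. Large \<open>n\<close> makes it approach the indicator of a closed
  half-line from outside.\<close>

lemma smoothstep_bump:
  fixes c d m n :: real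
  assumes "m > 0" "n > 0"
  defines "g \<equiv> \<lambda>x. smoothstep (n * (c - x) + 1) * smoothstep (m * (x - d) + 1)"
    and "g' \<equiv> \<lambda>x. - n * smoothstep_deriv (n * (c - x) + 1) * smoothstep (m * (x - d) + 1)
       + m * smoothstep (n * (c - x) + 1) * smoothstep_deriv (m * (x - d) + 1)"
  shows "C1_compact_support g g'"
  unfolding C1_compact_support_def
proof (intro conjI allI)
  fix x
  have 1: "((\<lambda>x. smoothstep (n * (c - x) + 1)) has_real_derivative smoothstep_deriv (n * (c - x) + 1) * (- n)) (at x)"
    by (rule DERIV_chain2[OF smoothstep_has_derivative]) (auto intro!: derivative_eq_intros)
  have 2: "((\<lambda>x. smoothstep (m * (x - d) + 1)) has_real_derivative smoothstep_deriv (m * (x - d) + 1) * m) (at x)"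
    by (rule DERIV_chain2[OF smoothstep_has_derivative]) (auto intro!: derivative_eq_intros)
  show "(g has_real_derivative g' x) (at x)"
    unfolding g_def g'_def by (rule DERIV_cong[OF DERIV_mult[OF 1 2]]) simp
next
  have s: "continuous_on UNIV smoothstep"
    by (intro continuous_at_imp_continuous_on ballI DERIV_isCont[OF smoothstep_has_derivative])
  show "continuous_on UNIV g'"
    unfolding g'_def
    by (intro continuous_intros continuous_on_compose2[OF s] continuous_on_compose2[OF smoothstep_deriv_continuous]) auto
  have "g x = 0" if "\<bar>x\<bar> > \<bar>c\<bar> + \<bar>d\<bar> + 1 / n + 1 / m" for x
  proof (cases "x > 0")
    case True
    have "1 / m > 0" using assms by simp
    then have "x - c > 1 / n" using that True by linarith
    then have "n * (x - c) > 1" using assms by (simp add: field_simps)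
    then have "n * (c - x) + 1 \<le> 0" by (simp add: algebra_simps)
    then show ?thesis by (simp add: g_def smoothstep_values)
  next
    case False
    have "1 / n > 0" using assms by simp
    then have "d - x > 1 / m" using that False by linarith
    then have "m * (d - x) > 1" using assms by (simp add: field_simps)
    then have "m * (x - d) + 1 \<le> 0" by (simp add: algebra_simps)
    then show ?thesis by (simp add: g_def smoothstep_values)
  qed
  then show "\<exists>R. \<forall>x. \<bar>x\<bar> > R \<longrightarrow> g x = 0" by blast
qed

text \<open>The cutoff \<open>\<eta>\<close> confines \<open>t\<close> and \<open>g\<close> confines
  \<open>s - t\<close>, so together they confine the pair. In the sum of the two partial derivatives
  the terms with \<open>g'\<close> cancel, leaving \<open>\<eta>' t * g (s - t)\<close>.\<close>

lemma test_function_transported: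
  assumes \<eta>: "C1_compact_support \<eta> \<eta>'" and g: "C1_compact_support g g'"
  shows "test_function (\<lambda>(t, s). \<eta> t * g (s - t)) (\<lambda>(t, s). \<eta>' t * g (s - t) - \<eta> t * g' (s - t))
    (\<lambda>(t, s). \<eta> t * g' (s - t))"
  unfolding test_function_def
proof (intro conjI allI)
  fix p :: "real \<times> real"
  have a: "((\<lambda>p. \<eta> (fst p)) has_derivative (\<lambda>h. \<eta>' (fst p) * fst h)) (at p)"
    by (rule has_derivative_compose[OF has_derivative_fst[OF has_derivative_ident]
          C1_compact_supportD(1)[OF \<eta>, unfolded has_field_derivative_def]])
  have b: "((\<lambda>p. g (snd p - fst p)) has_derivative (\<lambda>h. g' (snd p - fst p) * (snd h - fst h))) (at p)"
    by (rule has_derivative_compose[OF has_derivative_diff[OF has_derivative_snd[OF has_derivative_ident]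
          has_derivative_fst[OF has_derivative_ident]] C1_compact_supportD(1)[OF g, unfolded has_field_derivative_def]])
  show "((\<lambda>(t, s). \<eta> t * g (s - t)) has_derivative
     (\<lambda>h. (case p of (t, s) \<Rightarrow> \<eta>' t * g (s - t) - \<eta> t * g' (s - t)) * fst h + (case p of (t, s) \<Rightarrow> \<eta> t * g' (s - t)) * snd h)) (at p)"
    using has_derivative_mult[OF a b] by (simp add: case_prod_beta' case_prod_beta algebra_simps)
next
  show "continuous_on UNIV (\<lambda>(t, s). \<eta>' t * g (s - t) - \<eta> t * g' (s - t))"
    "continuous_on UNIV (\<lambda>(t, s). \<eta> t * g' (s - t))"
    unfolding case_prod_beta'
    by (intro continuous_intros continuous_on_compose2[OF C1_compact_supportD(2)[OF \<eta>, of UNIV]]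
      continuous_on_compose2[OF C1_compact_supportD(3)[OF \<eta>, of UNIV]]
      continuous_on_compose2[OF C1_compact_supportD(2)[OF g, of UNIV]]
      continuous_on_compose2[OF C1_compact_supportD(3)[OF g, of UNIV]]; simp)+
  obtain R R' where R: "\<And>x. \<bar>x\<bar> > R \<Longrightarrow> \<eta> x = 0" "\<And>x. \<bar>x\<bar> > R' \<Longrightarrow> g x = 0"
    using \<eta> g unfolding C1_compact_support_def by blast
  have "\<eta> t * g (s - t) = 0" if "(t, s) \<notin> {-\<bar>R\<bar>..\<bar>R\<bar>} \<times> {-\<bar>R\<bar> - \<bar>R'\<bar>..\<bar>R\<bar> + \<bar>R'\<bar>}" for t s
  proof (cases "\<bar>t\<bar> > R")
    case False
    with that have "\<bar>s - t\<bar> > R'" by auto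
    then show ?thesis using R by simp
  qed (use R in simp)
  then show "\<exists>K. compact K \<and> (\<forall>p. p \<notin> K \<longrightarrow> (case p of (t, s) \<Rightarrow> \<eta> t * g (s - t)) = 0)"
    by (intro exI[of _ "{-\<bar>R\<bar>..\<bar>R\<bar>} \<times> {-\<bar>R\<bar> - \<bar>R'\<bar>..\<bar>R\<bar> + \<bar>R'\<bar>}"] conjI compact_Times) auto
qed

section \<open>From time cutoffs to the integrated equation\<close>

lemma set_integral_indicator_subset:
  assumes "B \<subseteq> A"
  shows "(LINT x:A|M. indicator B x * f x) = (LINT x:B|M. f x :: real)"
  unfolding set_lebesgue_integral_def
  by (rule Bochner_Integration.integral_cong) (use assms in \<open>auto split: split_indicator\<close>)

text \<open>Here \<open>x\<close> and \<open>y\<close> stand for the values at time \<open>t\<close>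
  of the derivative of a time cutoff and of the cutoff itself. The indicator in the rate becomes a
  pairing over \<open>{\<tau>..}\<close>.\<close>

lemma transport_pairing_rate:
  assumes f: "continuous_L1 f" "t \<ge> 0" "\<tau> \<ge> 0" and g: "g \<in> borel_measurable borel" "\<And>x. \<bar>g x\<bar> \<le> B"
  shows "(LINT s:{0..}|lebesgue. f t s * (x * g (s - t) - (\<mu> + k * indicator {\<tau>..} s) * (y * g (s - t))))
    = x * transport_pairing f 0 g t - y * (\<mu> * transport_pairing f 0 g t + k * transport_pairing f \<tau> g t)"
proof -
  let ?h = "\<lambda>s. f t s * g (s - t)"
  have h0: "?h absolutely_integrable_on {0..}" and h1: "?h absolutely_integrable_on {\<tau>..}"
    by (rule transport_integrable[OF f(1,2) _ g], simp add: f(3))+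
  have "(\<lambda>s. indicator {\<tau>..} s * ?h s) absolutely_integrable_on {0..}"
  proof -
    have "(\<lambda>s. indicat_real {0..} s *\<^sub>R (indicator {\<tau>..} s * ?h s)) = (\<lambda>s. indicat_real {\<tau>..} s *\<^sub>R ?h s)"
      using f(3) by (auto split: split_indicator)
    then show ?thesis using h1 by (simp add: set_integrable_def)
  qed
  note h2 = set_integrable_mult_right[OF this, of "k * y"]
  note h3 = set_integrable_mult_right[OF h0, of "x - y * \<mu>"]
  have "(LINT s:{0..}|lebesgue. f t s * (x * g (s - t) - (\<mu> + k * indicator {\<tau>..} s) * (y * g (s - t))))
     = (LINT s:{0..}|lebesgue. (x - y * \<mu>) * ?h s - (k * y) * (indicator {\<tau>..} s * ?h s))"
    by (rule arg_cong[where f="set_lebesgue_integral lebesgue {0..}"]) (simp add: algebra_simps fun_eq_iff)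
  also have "\<dots> = (x - y * \<mu>) * (LINT s:{0..}|lebesgue. ?h s) - (k * y) * (LINT s:{0..}|lebesgue. indicator {\<tau>..} s * ?h s)"
    unfolding set_integral_diff(2)[OF h3 h2] by simp
  also have "(LINT s:{0..}|lebesgue. indicator {\<tau>..} s * ?h s) = (LINT s:{\<tau>..}|lebesgue. ?h s)"
    by (rule set_integral_indicator_subset) (use f(3) in auto)
  finally show ?thesis by (simp add: transport_pairing_def algebra_simps)
qed

lemma continuous_set_integral_eq_integral:
  fixes h :: "real \<Rightarrow> real"
  assumes "continuous_on {a..b} h"
  shows "(LINT t:{a..b}|lebesgue. h t) = integral {a..b} h"
  by (rule set_lebesgue_integral_eq_integral(2)[OF absolutely_integrable_continuous_real[OF assms]])

lemma set_integral_restrict_Icc: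
  fixes h :: "real \<Rightarrow> real"
  assumes "continuous_on {0..R} h" "\<And>t. t > R \<Longrightarrow> h t = 0"
  shows "(LINT t:{0..}|lebesgue. h t) = integral {0..R} h"
proof -
  have "(LINT t:{0..}|lebesgue. h t) = (LINT t:{0..R}|lebesgue. h t)"
    unfolding set_lebesgue_integral_def
    by (rule Bochner_Integration.integral_cong) (use assms in \<open>auto split: split_indicator simp: not_le\<close>)
  then show ?thesis using continuous_set_integral_eq_integral[OF assms(1)] by simp
qed

text \<open>The time derivative that the equation prescribes for
  \<open>transport_pairing f 0 g\<close>: inflow at \<open>s = 0\<close>, where the characteristic
  variable is \<open>- t\<close>, minus turnover, minus promotion.\<close>

definition transport_source ::
    "real \<Rightarrow> real \<Rightarrow> (real \<Rightarrow> real) \<Rightarrow> real \<Rightarrow> (real \<Rightarrow> real \<Rightarrow> real) \<Rightarrow> (real \<Rightarrow> real) \<Rightarrow> real \<Rightarrow> real" where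
  "transport_source b \<mu> k \<tau> f g t = b * g (- t) - \<mu> * transport_pairing f 0 g t - k t * transport_pairing f \<tau> g t"

lemma transport_source_continuous:
  assumes f: "continuous_L1 f" "\<tau> \<ge> 0" and g: "continuous_on UNIV g" "\<And>x. \<bar>g x\<bar> \<le> B" and k: "continuous_on {0..} k"
  shows "continuous_on {0..} (transport_source b \<mu> k \<tau> f g)"
proof -
  have g': "g \<in> borel_measurable borel" by (rule borel_measurable_continuous_onI[OF g(1)])
  have c: "isCont g x" for x using g(1) by (simp add: continuous_on_eq_continuous_at)
  have p: "continuous_on {0..} (transport_pairing f a g)" if "a \<ge> 0" for a
    by (rule transport_pairing_continuous[OF f(1) that g' g(2), of "{}"]) (simp_all add: c)
  show ?thesis unfolding transport_source_def[abs_def]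
    by (intro continuous_intros p k f continuous_on_compose2[OF g(1)]) auto
qed

text \<open>With the test function \<open>\<eta> t * g (s - t)\<close> the weak form becomes the
  distributional statement, in time alone, that the pairing has derivative
  \<open>transport_source\<close> and the initial value given by \<open>f\<^sub>0\<close>.\<close>

lemma weak_solution_tested:
  assumes w: "weak_solution (\<lambda>t s. \<mu> + k t * indicator {\<tau>..} s) b f\<^sub>0 f" and \<tau>: "\<tau> \<ge> 0"
    and k: "continuous_on {0..} k" and \<eta>: "C1_compact_support \<eta> \<eta>'" "\<And>t. t > R \<Longrightarrow> \<eta> t = 0" "\<And>t. t > R \<Longrightarrow> \<eta>' t = 0"
    and g: "C1_compact_support g g'" "\<And>x. \<bar>g x\<bar> \<le> B"
  shows "integral {0..R} (\<lambda>t. \<eta>' t * transport_pairing f 0 g t + \<eta> t * transport_source b \<mu> k \<tau> f g t)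
    + \<eta> 0 * (LINT s:{0..}|lebesgue. f\<^sub>0 s * g s) = 0"
proof -
  have f: "continuous_L1 f" using w by (simp add: weak_solution_def)
  note gm = C1_compact_supportD(5)[OF g(1)]
  let ?I = "transport_pairing f 0 g" and ?J = "transport_pairing f \<tau> g"
  have p: "continuous_on {0..R} (transport_pairing f a g)" if "a \<ge> 0" for a
    by (rule continuous_on_subset[OF transport_pairing_continuous[OF f that gm g(2), of "{}"]])
       (simp_all add: C1_compact_supportD(4)[OF g(1)])
  note k' = continuous_on_subset[OF k, of "{0..R}"]
  let ?A = "\<lambda>t. \<eta>' t * ?I t - \<eta> t * (\<mu> * ?I t + k t * ?J t)"
  let ?B = "\<lambda>t. b * (\<eta> t * g (- t))"
  have cA: "continuous_on {0..R} ?A" and cB: "continuous_on {0..R} ?B"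
    by (intro continuous_intros p k' \<tau> order.refl C1_compact_supportD(2,3)[OF \<eta>(1)]
       continuous_on_compose2[OF C1_compact_supportD(3)[OF g(1), of UNIV]]; auto)+
  have "(LINT t:{0..}|lebesgue. (LINT s:{0..}|lebesgue.
            f t s * ((\<eta>' t * g (s - t) - \<eta> t * g' (s - t)) + \<eta> t * g' (s - t) - (\<mu> + k t * indicator {\<tau>..} s) * (\<eta> t * g (s - t)))))
        + (LINT s:{0..}|lebesgue. f\<^sub>0 s * (\<eta> 0 * g (s - 0)))
        + (LINT t:{0..}|lebesgue. b * (\<eta> t * g (0 - t))) = 0"
    using w test_function_transported[OF \<eta>(1) g(1)] unfolding weak_solution_def by fastforce
  also have "(LINT t:{0..}|lebesgue. (LINT s:{0..}|lebesgue.
            f t s * ((\<eta>' t * g (s - t) - \<eta> t * g' (s - t)) + \<eta> t * g' (s - t) - (\<mu> + k t * indicator {\<tau>..} s) * (\<eta> t * g (s - t)))))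
     = (LINT t:{0..}|lebesgue. ?A t)"
    by (rule set_lebesgue_integral_cong) (auto simp: transport_pairing_rate[OF f _ \<tau> gm g(2)])
  also have "\<dots> = integral {0..R} ?A"
    by (rule set_integral_restrict_Icc[OF cA]) (simp add: \<eta>)
  also have "(LINT t:{0..}|lebesgue. b * (\<eta> t * g (0 - t))) = integral {0..R} ?B"
    using set_integral_restrict_Icc[OF cB] \<eta>(2) by simp
  also have "(LINT s:{0..}|lebesgue. f\<^sub>0 s * (\<eta> 0 * g (s - 0))) = \<eta> 0 * (LINT s:{0..}|lebesgue. f\<^sub>0 s * g s)"
    by (simp add: mult.left_commute)
  finally have "integral {0..R} ?A + integral {0..R} ?B + \<eta> 0 * (LINT s:{0..}|lebesgue. f\<^sub>0 s * g s) = 0"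
    by simp
  also have "integral {0..R} ?A + integral {0..R} ?B = integral {0..R} (\<lambda>t. ?A t + ?B t)"
    by (rule Henstock_Kurzweil_Integration.integral_add[symmetric]) (intro integrable_continuous_real cA cB)+
  also have "(\<lambda>t. ?A t + ?B t) = (\<lambda>t. \<eta>' t * ?I t + \<eta> t * transport_source b \<mu> k \<tau> f g t)"
    by (simp add: transport_source_def algebra_simps fun_eq_iff)
  finally show ?thesis .
qed

lemma continuous_on_Icc_bounded:
  fixes h :: "real \<Rightarrow> real"
  assumes "continuous_on {a..b} h"
  obtains B where "\<And>t. t \<in> {a..b} \<Longrightarrow> \<bar>h t\<bar> \<le> B"
  using compact_imp_bounded[OF compact_continuous_image[OF assms]] unfolding bounded_iff
  by (metis compact_Icc image_eqI real_norm_def)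

lemma abs_mult_le_1:
  fixes x y :: real
  shows "0 \<le> x \<Longrightarrow> x \<le> 1 \<Longrightarrow> 0 \<le> y \<Longrightarrow> y \<le> 1 \<Longrightarrow> \<bar>x * y\<bar> \<le> 1"
  using mult_le_one[of x y] by simp

lemma time_cutoff:
  assumes "e > (0::real)" "T \<ge> 0"
  obtains \<eta> \<eta>' where "C1_compact_support \<eta> \<eta>'" "\<And>t. t \<in> {0..T} \<Longrightarrow> \<eta> t = 1" "\<And>t. t \<in> {0..T} \<Longrightarrow> \<eta>' t = 0"
    "\<And>t. t \<ge> T + e \<Longrightarrow> \<eta> t = 0" "\<And>t. t \<ge> T + e \<Longrightarrow> \<eta>' t = 0" "\<And>t. \<bar>\<eta> t\<bar> \<le> 1" "\<And>t. t \<ge> 0 \<Longrightarrow> \<eta>' t \<le> 0"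
proof -
  let ?n = "1 / e"
  have a: "?n * (T - t) + 1 \<ge> 1" if "t \<le> T" for t using assms that by (simp add: field_simps)
  have b: "?n * (T - t) + 1 \<le> 0" if "t \<ge> T + e" for t using assms that by (simp add: field_simps)
  show ?thesis
    \<comment> \<open>The ascending factor, with \<open>d = -1\<close> and slope 1, is identically 1
      for \<open>t \<ge> -1\<close>. It only makes the support compact; on \<open>t \<ge> 0\<close>
      the cutoff is the descending step, hence nonincreasing.\<close>
    by (rule that[OF smoothstep_bump[of 1 ?n T "-1"]])
       (use assms a b in \<open>auto simp: smoothstep_values smoothstep_deriv_values smoothstep_bounds smoothstep_deriv_nonneg intro!: abs_mult_le_1 mult_le_one\<close>)
qed

text \<open>The time cutoff tends to the indicator of \<open>{0..T}\<close>, and minus its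
  derivative is a unit mass concentrating at \<open>T\<close> from the right. Continuity of the
  pairing then turns the term with \<open>\<eta>'\<close> into
  \<open>- transport_pairing f 0 g T\<close>.\<close>

lemma weak_solution_mild_C1:
  assumes w: "weak_solution (\<lambda>t s. \<mu> + k t * indicator {\<tau>..} s) b f\<^sub>0 f" and \<tau>: "\<tau> \<ge> 0"
    and k: "continuous_on {0..} k" and g: "C1_compact_support g g'" "\<And>x. \<bar>g x\<bar> \<le> B" and T: "T \<ge> 0"
  shows "transport_pairing f 0 g T
    = (LINT s:{0..}|lebesgue. f\<^sub>0 s * g s) + integral {0..T} (transport_source b \<mu> k \<tau> f g)"
proof -
  have f: "continuous_L1 f" using w by (simp add: weak_solution_def)
  note gm = C1_compact_supportD(5)[OF g(1)]
  let ?I = "transport_pairing f 0 g" and ?h = "transport_source b \<mu> k \<tau> f g" and ?F = "LINT s:{0..}|lebesgue. f\<^sub>0 s * g s"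
  have cI: "continuous_on {0..} ?I"
    by (rule transport_pairing_continuous[OF f _ gm g(2), of _ "{}"]) (simp_all add: C1_compact_supportD(4)[OF g(1)])
  have ch: "continuous_on {0..} ?h"
    by (rule transport_source_continuous[OF f \<tau> C1_compact_supportD(3)[OF g(1)] g(2) k])
  have bd: "\<bar>?F + integral {0..T} ?h - ?I T\<bar> \<le> 2 * \<epsilon>" if \<epsilon>: "\<epsilon> > 0" for \<epsilon>
  proof -
    obtain H where H: "\<And>t. t \<in> {0..T+1} \<Longrightarrow> \<bar>?h t\<bar> \<le> H"
      by (rule continuous_on_Icc_bounded[OF continuous_on_subset[OF ch, of "{0..T+1}"]]) auto
    have H0: "H \<ge> 0" using H[of 0] T by auto
    obtain d where d: "d > 0" "\<And>t. t \<ge> 0 \<Longrightarrow> \<bar>t - T\<bar> < d \<Longrightarrow> \<bar>?I t - ?I T\<bar> < \<epsilon>"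
      using cI T \<epsilon> unfolding continuous_on_iff dist_real_def by (meson atLeast_iff)
    \<comment> \<open>The transition layer \<open>{T..T+e}\<close> must lie in
      \<open>{0..T+1}\<close>, where \<open>H\<close> bounds the source, be short enough for the
      pairing to vary by less than \<open>\<epsilon>\<close>, and satisfy
      \<open>e * H \<le> \<epsilon>\<close>. Adding 1 to \<open>H\<close> covers
      \<open>H = 0\<close>.\<close>
    define e where "e = min 1 (min (d / 2) (\<epsilon> / (H + 1)))"
    have "\<epsilon> / (H + 1) > 0" using \<epsilon> H0 by simp
    then have e: "e > 0" "e \<le> 1" "e < d" "e \<le> \<epsilon> / (H + 1)" using d(1) unfolding e_def by linarith+
    have eH: "e * H \<le> \<epsilon>"
    proof -
      have "e * H \<le> \<epsilon> / (H + 1) * H" by (rule mult_right_mono[OF e(4) H0])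
      also have "\<dots> \<le> \<epsilon>" using \<epsilon> H0 by (simp add: field_simps)
      finally show ?thesis .
    qed
    obtain \<eta> \<eta>' where \<eta>: "C1_compact_support \<eta> \<eta>'" "\<And>t. t \<in> {0..T} \<Longrightarrow> \<eta> t = 1" "\<And>t. t \<in> {0..T} \<Longrightarrow> \<eta>' t = 0"
    "\<And>t. t \<ge> T + e \<Longrightarrow> \<eta> t = 0" "\<And>t. t \<ge> T + e \<Longrightarrow> \<eta>' t = 0" "\<And>t. \<bar>\<eta> t\<bar> \<le> 1" "\<And>t. t \<ge> 0 \<Longrightarrow> \<eta>' t \<le> 0"
      using time_cutoff[OF e(1) T] by blast
    let ?u = "\<lambda>t. \<eta>' t * ?I t" and ?v = "\<lambda>t. \<eta> t * ?h t"
    have cu: "continuous_on {x..y} ?u" and cv: "continuous_on {x..y} ?v" and c\<eta>: "continuous_on {x..y} \<eta>'" if "x \<ge> 0" for x y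
      by (intro continuous_intros C1_compact_supportD(2,3)[OF \<eta>(1)] continuous_on_subset[OF cI] continuous_on_subset[OF ch]; use that in auto)+
    have iu: "?u integrable_on {x..y}" and iv: "?v integrable_on {x..y}" and i\<eta>: "\<eta>' integrable_on {x..y}" if "x \<ge> 0" for x y
      by (intro integrable_continuous_real cu cv c\<eta> that)+
    have 0: "integral {0..T+e} (\<lambda>t. ?u t + ?v t) + ?F = 0"
      using weak_solution_tested[OF w \<tau> k \<eta>(1) _ _ g, of "T + e"] \<eta>(2)[of 0] \<eta>(4,5) T by simp
    have 1: "integral {0..T+e} (\<lambda>t. ?u t + ?v t) = integral {0..T+e} ?u + integral {0..T+e} ?v"
      by (rule Henstock_Kurzweil_Integration.integral_add) (intro iu iv order.refl)+
    have 2: "integral {0..T+e} ?u = integral {0..T} ?u + integral {T..T+e} ?u"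
      by (rule Henstock_Kurzweil_Integration.integral_combine[symmetric]) (use T e iu in auto)
    have 3: "integral {0..T+e} ?v = integral {0..T} ?v + integral {T..T+e} ?v"
      by (rule Henstock_Kurzweil_Integration.integral_combine[symmetric]) (use T e iv in auto)
    have "integral {0..T} ?u = integral {0..T} (\<lambda>t. 0)"
      by (rule Henstock_Kurzweil_Integration.integral_cong) (simp add: \<eta>(3))
    then have 4: "integral {0..T} ?u = 0" by simp
    have 7: "integral {0..T} ?v = integral {0..T} ?h"
      by (rule Henstock_Kurzweil_Integration.integral_cong) (simp add: \<eta>(2))
    have ftc: "integral {T..T+e} \<eta>' = -1"
    proof -
      have "(\<eta>' has_integral (\<eta> (T + e) - \<eta> T)) {T..T+e}"
        by (rule fundamental_theorem_of_calculus)
           (use e C1_compact_supportD(1)[OF \<eta>(1)] in \<open>auto simp: has_real_derivative_iff_has_vector_derivative intro: has_vector_derivative_at_within\<close>)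
      then show ?thesis using \<eta>(2)[of T] \<eta>(4)[of "T+e"] T by (simp add: integral_unique)
    qed
    have 5: "\<bar>integral {T..T+e} ?u + ?I T\<bar> \<le> \<epsilon>"
    proof -
      \<comment> \<open>Since \<open>\<eta>'\<close> integrates to -1 over the layer, the constant
        \<open>?I T\<close> can be written as an average against \<open>- \<eta>'\<close>, whose
        weight is nonnegative.\<close>
      have "integral {T..T+e} ?u + ?I T = integral {T..T+e} ?u - integral {T..T+e} (\<lambda>t. \<eta>' t * ?I T)"
        using ftc by simp
      also have "\<dots> = integral {T..T+e} (\<lambda>t. ?u t - \<eta>' t * ?I T)"
        by (rule Henstock_Kurzweil_Integration.integral_diff[symmetric]) (use T iu i\<eta> in \<open>auto intro!: integrable_on_mult_left\<close>)
      finally have *: "integral {T..T+e} ?u + ?I T = integral {T..T+e} (\<lambda>t. ?u t - \<eta>' t * ?I T)" .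
      have "norm (integral {T..T+e} (\<lambda>t. ?u t - \<eta>' t * ?I T)) \<le> integral {T..T+e} (\<lambda>t. - \<eta>' t * \<epsilon>)"
      proof (rule integral_norm_bound_integral)
        fix t assume t: "t \<in> {T..T+e}"
        then have "\<bar>?I t - ?I T\<bar> \<le> \<epsilon>" using d(2)[of t] e T by auto
        then have "- \<eta>' t * \<bar>?I t - ?I T\<bar> \<le> - \<eta>' t * \<epsilon>"
          using \<eta>(7)[of t] t T by (intro mult_left_mono) auto
        then show "norm (?u t - \<eta>' t * ?I T) \<le> - \<eta>' t * \<epsilon>"
          using \<eta>(7)[of t] t T by (simp add: abs_mult flip: right_diff_distrib)
      qed (use T iu i\<eta> in \<open>auto intro!: integrable_on_mult_left integrable_diff integrable_neg\<close>)
      also have "\<dots> = \<epsilon>" using ftc by simp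
      finally show ?thesis using * by simp
    qed
    have 6: "\<bar>integral {T..T+e} ?v\<bar> \<le> \<epsilon>"
    proof -
      have "norm (integral {T..T+e} ?v) \<le> H * (T + e - T)"
      proof (rule integral_bound)
        fix t assume t: "t \<in> {T..T+e}"
        then have "\<bar>\<eta> t\<bar> * \<bar>?h t\<bar> \<le> 1 * H" using \<eta>(6)[of t] H[of t] e T H0 by (intro mult_mono) auto
        then show "norm (?v t) \<le> H" by (simp add: abs_mult)
      qed (use e T cv in auto)
      then show ?thesis using eH by (simp add: mult.commute)
    qed
    show ?thesis using 0 1 2 3 4 5 6 7 by linarith
  qed
  have "\<bar>?F + integral {0..T} ?h - ?I T\<bar> \<le> 0 + \<epsilon>" if "\<epsilon> > 0" for \<epsilon>
    using bd[of "\<epsilon> / 2"] that by simp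
  then have "\<bar>?F + integral {0..T} ?h - ?I T\<bar> \<le> 0" by (rule field_le_epsilon)
  then show ?thesis by linarith
qed

text \<open>Rays form an intersection-stable generator of the Borel sets, so vanishing integrals
  over rays extend to all Borel sets and force the density to vanish. The argument runs on a Borel
  representative of the extension by zero and is carried back through the completion.\<close>

lemma AE_zero_if_integrals_Icc_zero:
  fixes h :: "real \<Rightarrow> real"
  assumes h: "h absolutely_integrable_on {0..}" and z: "\<And>q. q \<ge> 0 \<Longrightarrow> (LINT s:{0..q}|lebesgue. h s) = 0"
  shows "AE s in lebesgue. s \<ge> 0 \<longrightarrow> h s = 0"
proof -
  let ?H = "\<lambda>s. indicator {0..} s * h s"
  have H: "integrable lebesgue ?H" using h by (simp add: set_integrable_def)
  from completion_ex_borel_measurable_real[OF borel_measurable_integrable[OF H]]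
  obtain H' where H'm [measurable]: "H' \<in> borel_measurable lborel" and ae: "AE s in lborel. ?H s = H' s"
    by (elim bexE)
  note ae' = AE_completion[OF ae]
  have Hm: "H' \<in> borel_measurable lebesgue" by (rule measurable_completion[OF H'm])
  have "integrable lebesgue H'"
    by (rule integrable_cong_AE_imp[OF H Hm ae'])
  then have H': "integrable lborel H'" by (simp add: integrable_completion)
  have q: "(LINT s:{..q}|lborel. H' s) = 0" for q
  proof -
    have "(LINT s:{..q}|lborel. H' s) = (LINT s|lebesgue. indicator {..q} s *\<^sub>R H' s)"
      unfolding set_lebesgue_integral_def by (rule integral_completion[symmetric]) simp
    also have "\<dots> = (LINT s|lebesgue. indicator {..q} s *\<^sub>R ?H s)"
    proof (rule integral_cong_AE)
      show "AE s in lebesgue. indicator {..q} s *\<^sub>R H' s = indicator {..q} s *\<^sub>R ?H s"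
        using ae' by eventually_elim simp
    qed (intro borel_measurable_scaleR borel_measurable_indicator Hm borel_measurable_integrable[OF H]; simp)+
    also have "\<dots> = (LINT s:{0..q}|lebesgue. h s)"
      unfolding set_lebesgue_integral_def by (rule Bochner_Integration.integral_cong) (auto split: split_indicator)
    also have "\<dots> = 0"
      by (cases "q \<ge> 0") (simp add: z, simp add: set_lebesgue_integral_def)
    finally show ?thesis .
  qed
  \<comment> \<open>The integral over the whole line must vanish too, for the complement step of the
    induction below.\<close>
  have "(\<lambda>n. LINT s|lborel. indicator {..real n} s *\<^sub>R H' s) \<longlonglongrightarrow> (LINT s|lborel. H' s)"
  proof (rule integral_dominated_convergence[where w="\<lambda>s. norm (H' s)"])
    have "(\<lambda>n. indicator {..real n} s *\<^sub>R H' s) \<longlonglongrightarrow> H' s" for s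
    proof (rule tendsto_eventually)
      show "\<forall>\<^sub>F n in sequentially. indicator {..real n} s *\<^sub>R H' s = H' s"
        using eventually_ge_at_top[of "nat \<lceil>s\<rceil>"] by eventually_elim (simp add: nat_le_iff ceiling_le_iff)
    qed
    then show "AE s in lborel. (\<lambda>n. indicator {..real n} s *\<^sub>R H' s) \<longlonglongrightarrow> H' s" by simp
  qed (use H' in \<open>auto split: split_indicator\<close>)
  with q have tot: "(LINT s|lborel. H' s) = 0"
    by (simp add: set_lebesgue_integral_def LIMSEQ_const_iff)
  have si: "set_integrable lborel A H'" if "A \<in> sets borel" for A
    using integrable_mult_indicator[OF _ H', of A] that by (simp add: set_integrable_def)
  have "(LINT s:A|lborel. H' s) = 0" if A: "A \<in> sets borel" for A
  proof -
    have "Int_stable (range (atMost :: real \<Rightarrow> real set))"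
      by (auto simp: Int_stable_def)
    moreover have "range (atMost :: real \<Rightarrow> real set) \<subseteq> Pow UNIV" by simp
    moreover have "A \<in> sigma_sets UNIV (range atMost)"
      using A by (subst (asm) borel_eq_atMost) (simp add: image_def)
    ultimately show ?thesis
    proof (induction rule: sigma_sets_induct_disjoint)
      case (compl A)
      then have A: "A \<in> sets borel" by (subst borel_eq_atMost) simp
      have "(LINT s:UNIV - A|lborel. H' s) + (LINT s:A|lborel. H' s) = (LINT s:(UNIV - A) \<union> A|lborel. H' s)"
        by (rule set_integral_Un[symmetric]) (use A si in auto)
      also have "\<dots> = 0" using tot by (simp add: set_lebesgue_integral_def)
      finally show ?case using compl by simp
    next
      case (union A)
      have A: "A i \<in> sets borel" for i using union(2) by (subst borel_eq_atMost) auto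
      have "(LINT s:(\<Union>i. A i)|lborel. H' s) = (\<Sum>i. (LINT s:A i|lborel. H' s))"
        by (rule lebesgue_integral_countable_add)
           (use A union(1) si[of "\<Union>i. A i"] in \<open>auto simp: disjoint_family_on_def\<close>)
      then show ?case using union(3) by simp
    qed (use q in \<open>auto simp: set_lebesgue_integral_def\<close>)
  qed
  then have "AE s in lborel. H' s = 0" by (intro sigma_finite_measure.density_zero[OF sigma_finite_lborel H']) simp
  from AE_completion[OF this] ae' show ?thesis by eventually_elim (auto split: split_indicator_asm)
qed

text \<open>Integrating factor: the integral equation makes the continuous \<open>v\<close>
  differentiable, and \<open>v\<close> times the exponential of the integrated coefficient is then
  constant. No sign of the coefficient is assumed.\<close>

lemma linear_ode_solution:
  fixes v \<kappa> :: "real \<Rightarrow> real"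
  assumes "a \<le> T" and v: "continuous_on {a..T} v" and \<kappa>: "continuous_on {a..T} \<kappa>"
    and eq: "\<And>t. t \<in> {a..T} \<Longrightarrow> v t = v\<^sub>0 - integral {a..t} (\<lambda>s. \<kappa> s * v s)"
  shows "v T = v\<^sub>0 * exp (- integral {a..T} \<kappa>)"
proof -
  let ?K = "\<lambda>t. integral {a..t} \<kappa>"
  have dK: "(?K has_real_derivative \<kappa> t) (at t within {a..T})" if "t \<in> {a..T}" for t
    by (rule integral_has_real_derivative[OF \<kappa> that])
  have dv: "(v has_real_derivative - (\<kappa> t * v t)) (at t within {a..T})" if t: "t \<in> {a..T}" for t
  proof -
    have "((\<lambda>t. v\<^sub>0 - integral {a..t} (\<lambda>s. \<kappa> s * v s)) has_real_derivative - (\<kappa> t * v t)) (at t within {a..T})"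
      by (rule DERIV_cong[OF DERIV_diff[OF DERIV_const integral_has_real_derivative[OF continuous_on_mult[OF \<kappa> v] t]]]) simp
    then show ?thesis
      by (rule has_field_derivative_transform_within[OF _ zero_less_one t]) (use eq in auto)
  qed
  have "((\<lambda>t. v t * exp (?K t)) has_real_derivative 0) (at t within {a..T})" if "t \<in> {a..T}" for t
    by (rule DERIV_cong[OF DERIV_mult[OF dv[OF that] DERIV_chain2[OF DERIV_exp dK[OF that]]]]) simp
  then have "\<exists>c. \<forall>t\<in>{a..T}. v t * exp (?K t) = c"
    by (intro has_field_derivative_zero_constant) auto
  then obtain c where "\<And>t. t \<in> {a..T} \<Longrightarrow> v t * exp (?K t) = c" by blast
  from this[of T] this[of a] have "v T * exp (?K T) = v a * exp (?K a)" using \<open>a \<le> T\<close> by simp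
  moreover have "v a = v\<^sub>0" using eq[of a] \<open>a \<le> T\<close> by simp
  ultimately show ?thesis by (simp add: exp_minus field_simps)
qed

text \<open>For a profile with jumps the inflow term \<open>b * g (- t)\<close> jumps in time, so
  integrability replaces the continuity that holds for continuous profiles. The two pairings remain
  continuous.\<close>

lemma transport_source_integrable:
  assumes f: "continuous_L1 f" "\<tau> \<ge> 0" and k: "continuous_on {0..} k"
    and g: "g \<in> borel_measurable borel" "\<And>x. \<bar>g x\<bar> \<le> B" "finite D" "\<And>x. x \<notin> D \<Longrightarrow> isCont g x"
  shows "transport_source b \<mu> k \<tau> f g absolutely_integrable_on {0..T}"
proof -
  have "(\<lambda>t. b * g (- t)) absolutely_integrable_on {0..T}"
    by (rule absolutely_integrable_times_bounded_borel[OF _ _ shift_measurable_lebesgue(2)[OF g(1)] g(2)])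
       (auto intro!: absolutely_integrable_continuous_real)
  moreover have "continuous_on {0..T} (transport_pairing f a g)" if "a \<ge> 0" for a
    by (rule continuous_on_subset[OF transport_pairing_continuous[OF f(1) that g]]) auto
  then have "(\<lambda>t. \<mu> * transport_pairing f 0 g t) absolutely_integrable_on {0..T}"
     "(\<lambda>t. k t * transport_pairing f \<tau> g t) absolutely_integrable_on {0..T}"
    using f(2) continuous_on_subset[OF k, of "{0..T}"]
    by (auto intro!: absolutely_integrable_continuous_real continuous_on_mult simp del: set_integrable_mult_right_iff)
  ultimately show ?thesis
    unfolding transport_source_def[abs_def] by (intro set_integral_diff(1))
qed

text \<open>Bounded pointwise convergence of the profiles passes through all three terms by
  dominated convergence: in \<open>s\<close> for the pairings and the initial term, in
  \<open>t\<close> for the source. Continuity of \<open>g\<close> off a finite set makes the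
  limiting source integrable.\<close>

lemma weak_solution_mild_limit:
  assumes w: "weak_solution (\<lambda>t s. \<mu> + k t * indicator {\<tau>..} s) b f\<^sub>0 f" and \<tau>: "\<tau> \<ge> 0"
    and k: "continuous_on {0..} k" and f0: "f\<^sub>0 absolutely_integrable_on {0..}"
    and G: "\<And>n. C1_compact_support (G n) (G' n)" "\<And>n x. \<bar>G n x\<bar> \<le> 1" "\<And>x. (\<lambda>n. G n x) \<longlonglongrightarrow> g x"
    and g: "finite D" "\<And>x. x \<notin> D \<Longrightarrow> isCont g x" and T: "T \<ge> 0"
  shows "transport_pairing f 0 g T
    = (LINT s:{0..}|lebesgue. f\<^sub>0 s * g s) + integral {0..T} (transport_source b \<mu> k \<tau> f g)"
proof -
  have f: "continuous_L1 f" using w by (simp add: weak_solution_def)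
  note Gm = C1_compact_supportD(5)[OF G(1)]
  have gm: "g \<in> borel_measurable borel" by (rule borel_measurable_LIMSEQ_real[OF G(3) Gm])
  have gb: "\<bar>g x\<bar> \<le> 1" for x
    by (rule LIMSEQ_le_const2[OF tendsto_rabs[OF G(3)]]) (use G(2) in auto)
  have p: "(\<lambda>n. transport_pairing f a (G n) t) \<longlonglongrightarrow> transport_pairing f a g t" if "a \<ge> 0" "t \<ge> 0" for a t
    unfolding transport_pairing_def
  proof (rule set_integral_dominated_convergence)
    show "(\<lambda>s. 1 * \<bar>f t s\<bar>) absolutely_integrable_on {a..}"
      by (rule set_integrable_mult_right[OF set_integrable_abs[OF continuous_L1_integrable[OF f that(2,1)]]])
    show "(\<lambda>s. f t s * G n (s - t)) absolutely_integrable_on {a..}" for n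
      by (rule transport_integrable[OF f that(2,1) Gm G(2)])
    show "(\<lambda>s. f t s * g (s - t)) absolutely_integrable_on {a..}"
      by (rule transport_integrable[OF f that(2,1) gm gb])
    show "AE s in lebesgue. s \<in> {a..} \<longrightarrow> (\<lambda>n. f t s * G n (s - t)) \<longlonglongrightarrow> f t s * g (s - t)"
      by (intro AE_I2 impI tendsto_intros G)
  qed (rule abs_mult_le_bound[OF G(2)])
  have F: "(\<lambda>n. LINT s:{0..}|lebesgue. f\<^sub>0 s * G n s) \<longlonglongrightarrow> (LINT s:{0..}|lebesgue. f\<^sub>0 s * g s)"
  proof (rule set_integral_dominated_convergence)
    show "(\<lambda>s. 1 * \<bar>f\<^sub>0 s\<bar>) absolutely_integrable_on {0..}"
      by (rule set_integrable_mult_right[OF set_integrable_abs[OF f0]])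
    show "(\<lambda>s. f\<^sub>0 s * G n s) absolutely_integrable_on {0..}" for n
      by (rule absolutely_integrable_times_bounded_borel[OF f0 _ shift_measurable_lebesgue(3)[OF Gm] G(2)]) simp
    show "(\<lambda>s. f\<^sub>0 s * g s) absolutely_integrable_on {0..}"
      by (rule absolutely_integrable_times_bounded_borel[OF f0 _ shift_measurable_lebesgue(3)[OF gm] gb]) simp
    show "AE s in lebesgue. s \<in> {0..} \<longrightarrow> (\<lambda>n. f\<^sub>0 s * G n s) \<longlonglongrightarrow> f\<^sub>0 s * g s"
      by (intro AE_I2 impI tendsto_intros G)
  qed (rule abs_mult_le_bound[OF G(2)])
  obtain M where M: "M \<ge> 0" "\<And>t. t \<in> {0..T} \<Longrightarrow> (LINT s:{0..}|lebesgue. \<bar>f t s\<bar>) \<le> M"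
    using continuous_L1_norm_bounded[OF f] by blast
  obtain Kb where Kb: "\<And>t. t \<in> {0..T} \<Longrightarrow> \<bar>k t\<bar> \<le> Kb"
    by (rule continuous_on_Icc_bounded[OF continuous_on_subset[OF k, of "{0..T}"]]) auto
  have S: "(\<lambda>n. LINT t:{0..T}|lebesgue. transport_source b \<mu> k \<tau> f (G n) t) \<longlonglongrightarrow>
      (LINT t:{0..T}|lebesgue. transport_source b \<mu> k \<tau> f g t)"
  proof (rule set_integral_dominated_convergence)
    \<comment> \<open>One summand for each term of the source, with profiles bounded by 1, pairings
      by the norm bound \<open>M\<close> and the rate by \<open>Kb\<close>.\<close>
    show "(\<lambda>t. \<bar>b\<bar> + \<bar>\<mu>\<bar> * M + Kb * M) absolutely_integrable_on {0..T}"
      by (intro absolutely_integrable_continuous_real continuous_intros)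
    show "transport_source b \<mu> k \<tau> f (G n) absolutely_integrable_on {0..T}" for n
      by (rule transport_source_integrable[OF f \<tau> k Gm G(2), of "{}"]) (simp_all add: C1_compact_supportD(4)[OF G(1)])
    show "transport_source b \<mu> k \<tau> f g absolutely_integrable_on {0..T}"
      by (rule transport_source_integrable[OF f \<tau> k gm gb g])
    show "AE t in lebesgue. t \<in> {0..T} \<longrightarrow> (\<lambda>n. transport_source b \<mu> k \<tau> f (G n) t) \<longlonglongrightarrow> transport_source b \<mu> k \<tau> f g t"
      unfolding transport_source_def by (intro AE_I2 impI tendsto_intros G p \<tau>) auto
    fix n t assume t: "t \<in> {0..T}"
    have q: "\<bar>transport_pairing f a (G n) t\<bar> \<le> M" if "a \<ge> 0" for a
      using transport_pairing_bound[OF f _ that Gm G(2), of t n] M(2)[OF t] t by auto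
    have "\<bar>b * G n (- t)\<bar> \<le> 1 * \<bar>b\<bar>" by (rule abs_mult_le_bound[OF G(2)])
    moreover have "\<bar>\<mu> * transport_pairing f 0 (G n) t\<bar> \<le> \<bar>\<mu>\<bar> * M"
      unfolding abs_mult by (intro mult_left_mono q) auto
    moreover have "\<bar>k t * transport_pairing f \<tau> (G n) t\<bar> \<le> Kb * M"
      unfolding abs_mult using Kb[OF t] by (intro mult_mono q \<tau>) auto
    ultimately show "\<bar>transport_source b \<mu> k \<tau> f (G n) t\<bar> \<le> \<bar>b\<bar> + \<bar>\<mu>\<bar> * M + Kb * M"
      unfolding transport_source_def by linarith
  qed
  have e: "transport_pairing f 0 (G n) T
    = (LINT s:{0..}|lebesgue. f\<^sub>0 s * G n s) + (LINT t:{0..T}|lebesgue. transport_source b \<mu> k \<tau> f (G n) t)" for n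
    using weak_solution_mild_C1[OF w \<tau> k G(1) G(2) T, of n]
      continuous_set_integral_eq_integral[OF continuous_on_subset[OF transport_source_continuous[OF f \<tau> C1_compact_supportD(3)[OF G(1)] G(2) k]], of 0 T]
    by auto
  have "transport_pairing f 0 g T = (LINT s:{0..}|lebesgue. f\<^sub>0 s * g s) + (LINT t:{0..T}|lebesgue. transport_source b \<mu> k \<tau> f g t)"
    using LIMSEQ_unique[OF p[OF order.refl T, unfolded e] tendsto_add[OF F S]] .
  then show ?thesis
    using set_lebesgue_integral_eq_integral(2)[OF transport_source_integrable[OF f \<tau> k gm gb g]] by simp
qed

lemma isCont_indicator_atMost: "x \<noteq> c \<Longrightarrow> isCont (indicator {..c} :: real \<Rightarrow> real) x"
  by (simp add: isCont_indicator frontier_def interior_real_atMost)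

text \<open>The approximating bumps descend just to the right of \<open>c\<close> with slope
  \<open>Suc n\<close> and ascend near \<open>- n\<close>. At each point they eventually equal the
  limit, including at \<open>c\<close> itself. The successor keeps the slope positive for
  \<open>n = 0\<close>.\<close>

lemma weak_solution_mild_atMost:
  assumes w: "weak_solution (\<lambda>t s. \<mu> + k t * indicator {\<tau>..} s) b f\<^sub>0 f" and \<tau>: "\<tau> \<ge> 0"
    and k: "continuous_on {0..} k" and f0: "f\<^sub>0 absolutely_integrable_on {0..}" and T: "T \<ge> 0"
  shows "transport_pairing f 0 (indicator {..c}) T
    = (LINT s:{0..}|lebesgue. f\<^sub>0 s * indicator {..c} s) + integral {0..T} (transport_source b \<mu> k \<tau> f (indicator {..c}))"
proof (rule weak_solution_mild_limit[OF w \<tau> k f0 smoothstep_bump _ _ _ _ T])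
  fix n :: nat and x :: real
  show "(1::real) > 0" "real (Suc n) > 0" by auto
  show "\<bar>smoothstep (real (Suc n) * (c - x) + 1) * smoothstep (1 * (x - (- real n)) + 1)\<bar> \<le> 1"
    by (intro abs_mult_le_1 smoothstep_bounds)
  have "\<forall>\<^sub>F n in sequentially. smoothstep (1 * (x - (- real n)) + 1) = 1"
    using eventually_ge_at_top[of "nat \<lceil>- x\<rceil>"] 
    by eventually_elim (auto intro!: smoothstep_values simp: nat_le_iff ceiling_le_iff)
  moreover have "\<forall>\<^sub>F n in sequentially. smoothstep (real (Suc n) * (c - x) + 1) = indicator {..c} x"
  proof (cases "x \<le> c")
    case True
    then show ?thesis by (intro always_eventually allI) (simp add: smoothstep_values)
  next
    case False
    show ?thesis using eventually_ge_at_top[of "nat \<lceil>1 / (x - c)\<rceil>"]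
    proof eventually_elim
      case (elim n)
      then have "1 / (x - c) \<le> real (Suc n)" by linarith
      then have "1 \<le> real (Suc n) * (x - c)" using False by (simp add: pos_divide_le_eq)
      then have "real (Suc n) * (c - x) + 1 \<le> 0" by (simp add: algebra_simps)
      then show ?case using False by (simp add: smoothstep_values)
    qed
  qed
  ultimately have "\<forall>\<^sub>F n in sequentially. smoothstep (real (Suc n) * (c - x) + 1) * smoothstep (1 * (x - (- real n)) + 1) = indicator {..c} x"
    by eventually_elim simp
  then show "(\<lambda>n. smoothstep (real (Suc n) * (c - x) + 1) * smoothstep (1 * (x - (- real n)) + 1))
       \<longlonglongrightarrow> indicator {..c} x"
    by (rule tendsto_eventually)
  show "finite {c}" by simp
  show "isCont (indicat_real {..c}) x" if "x \<notin> {c}"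
    using that by (simp add: isCont_indicator_atMost)
qed

lemma weak_solution_mild_1:
  assumes w: "weak_solution (\<lambda>t s. \<mu> + k t * indicator {\<tau>..} s) b f\<^sub>0 f" and \<tau>: "\<tau> \<ge> 0"
    and k: "continuous_on {0..} k" and f0: "f\<^sub>0 absolutely_integrable_on {0..}" and T: "T \<ge> 0"
  shows "transport_pairing f 0 (\<lambda>_. 1) T
    = (LINT s:{0..}|lebesgue. f\<^sub>0 s * 1) + integral {0..T} (transport_source b \<mu> k \<tau> f (\<lambda>_. 1))"
proof (rule weak_solution_mild_limit[OF w \<tau> k f0 smoothstep_bump _ _ _ _ T])
  fix n :: nat and x :: real
  show "(1::real) > 0" "(1::real) > 0" by auto
  show "\<bar>smoothstep (1 * (real n - x) + 1) * smoothstep (1 * (x - (- real n)) + 1)\<bar> \<le> 1"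
    by (intro abs_mult_le_1 smoothstep_bounds)
  show "(\<lambda>n. smoothstep (1 * (real n - x) + 1) * smoothstep (1 * (x - (- real n)) + 1)) \<longlonglongrightarrow> 1"
  proof (rule tendsto_eventually)
    show "\<forall>\<^sub>F n in sequentially. smoothstep (1 * (real n - x) + 1) * smoothstep (1 * (x - (- real n)) + 1) = 1"
      using eventually_ge_at_top[of "nat \<lceil>\<bar>x\<bar>\<rceil>"]
    proof eventually_elim
      case (elim n)
      then have "\<bar>x\<bar> \<le> real n" by linarith
      then show ?case by (subst (1 2) smoothstep_values(2)) auto
    qed
  qed
qed auto

subsection \<open>Mass balance and uniqueness\<close>

text \<open>The upper end \<open>c + t\<close> moves with the characteristic, so this is the mass
  behind a fixed cohort.\<close>

lemma transport_pairing_atMost: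
  assumes "a \<ge> 0"
  shows "transport_pairing f a (indicator {..c}) t = (LINT s:{a..c+t}|lebesgue. f t s)"
  unfolding transport_pairing_def set_lebesgue_integral_def
  by (rule Bochner_Integration.integral_cong) (use assms in \<open>auto split: split_indicator\<close>)

lemma transport_pairing_atMost_continuous:
  assumes "continuous_L1 f" "a \<ge> 0"
  shows "continuous_on {0..} (transport_pairing f a (indicator {..c}))"
  by (rule transport_pairing_continuous[OF assms, of _ 1 "{c}"]) (auto simp: isCont_indicator_atMost split: split_indicator)

lemma transport_source_atMost_integrable:
  assumes "continuous_L1 f" "\<tau> \<ge> 0" "continuous_on {0..} k"
  shows "transport_source b \<mu> k \<tau> f (indicator {..c}) absolutely_integrable_on {0..T}"
  by (rule transport_source_integrable[OF assms, of _ 1 "{c}"]) (auto simp: isCont_indicator_atMost split: split_indicator)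

lemma set_integral_null:
  fixes h :: "real \<Rightarrow> real"
  assumes "AE s in lebesgue. s \<in> S \<longrightarrow> h s = 0"
  shows "(LINT s:S|lebesgue. h s) = 0"
  unfolding set_lebesgue_integral_def
  by (rule integral_eq_zero_AE) (use assms in eventually_elim, auto split: split_indicator)

lemma AE_lebesgue_neq: "AE s in lebesgue. s \<noteq> (c::real)"
  using AE_shift_notin_finite[of "{c}" 0] by simp

text \<open>Follow the characteristic that reaches seniority \<open>q\<close> at time
  \<open>T\<close>. Up to then everything behind it has seniority at most \<open>\<tau>\<close>, so
  promotion does not act, and the mass behind it obeys a linear equation with equilibrium
  \<open>b / \<mu>\<close>. If \<open>q < T\<close>, the characteristic enters through the boundary
  with no mass behind it, which the empty interval \<open>{0..q - T}\<close> encodes.\<close>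

lemma mass_below_threshold:
  assumes w: "weak_solution (\<lambda>t s. \<mu> + k t * indicator {\<tau>..} s) b f\<^sub>0 f" and \<tau>: "\<tau> \<ge> 0"
    and k: "continuous_on {0..} k" and f0: "f\<^sub>0 absolutely_integrable_on {0..}" and T: "T \<ge> 0"
    and q: "0 \<le> q" "q \<le> \<tau>" and \<mu>: "\<mu> > 0"
  shows "(LINT s:{0..q}|lebesgue. f T s)
    = b / \<mu> + ((LINT s:{0..q - T}|lebesgue. f\<^sub>0 s) - b / \<mu>) * exp (- (\<mu> * min T q))"
proof -
  define c where "c = q - T"
  \<comment> \<open>The time at which the characteristic \<open>s - t = c\<close> enters the
    quadrant. The elapsed time \<open>T - t0\<close> is the \<open>min T q\<close> of the
    exponent.\<close>
  define t0 where "t0 = max 0 (- c)"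
  have f: "continuous_L1 f" using w by (simp add: weak_solution_def)
  let ?g = "indicator {..c} :: real \<Rightarrow> real"
  let ?I = "transport_pairing f 0 ?g" and ?S = "transport_source b \<mu> k \<tau> f ?g"
  have t0: "0 \<le> t0" "t0 \<le> T" using T q by (auto simp: t0_def c_def)
  have cI: "continuous_on {t0..T} ?I"
    by (rule continuous_on_subset[OF transport_pairing_atMost_continuous[OF f order.refl]]) (use t0 in auto)
  \<comment> \<open>Here \<open>c + t \<le> q \<le> \<tau>\<close>, so at most the single seniority
    \<open>s = \<tau>\<close> remains.\<close>
  have J: "transport_pairing f \<tau> ?g t = 0" if "t \<le> T" for t
    unfolding transport_pairing_def
  proof (rule set_integral_null)
    show "AE s in lebesgue. s \<in> {\<tau>..} \<longrightarrow> f t s * ?g (s - t) = 0"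
      using AE_lebesgue_neq[of \<tau>] by eventually_elim (use that q in \<open>auto simp: c_def split: split_indicator\<close>)
  qed
  have mild: "?I t = (LINT s:{0..}|lebesgue. f\<^sub>0 s * ?g s) + integral {0..t} ?S" if "t \<ge> 0" for t
    by (rule weak_solution_mild_atMost[OF w \<tau> k f0 that])
  have F: "(LINT s:{0..}|lebesgue. f\<^sub>0 s * ?g s) = (LINT s:{0..c}|lebesgue. f\<^sub>0 s)"
    unfolding set_lebesgue_integral_def
    by (rule Bochner_Integration.integral_cong) (auto split: split_indicator)
  have I0: "?I t0 = (LINT s:{0..c}|lebesgue. f\<^sub>0 s)"
  proof (cases "c \<ge> 0")
    case True
    then show ?thesis using mild[of 0] F by (simp add: t0_def)
  next
    case False
    have "?I t0 = 0"
      unfolding transport_pairing_def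
    proof (rule set_integral_null)
      show "AE s in lebesgue. s \<in> {0..} \<longrightarrow> f t0 s * ?g (s - t0) = 0"
        using AE_lebesgue_neq[of 0] by eventually_elim (use False in \<open>auto simp: t0_def split: split_indicator\<close>)
    qed
    then show ?thesis using False by (simp add: set_lebesgue_integral_def)
  qed
  have iS: "?S integrable_on {0..t}" for t
    by (rule set_lebesgue_integral_eq_integral(1)[OF transport_source_atMost_integrable[OF f \<tau> k]])
  have "?I t - b / \<mu> = (?I t0 - b / \<mu>) - integral {t0..t} (\<lambda>s. \<mu> * (?I s - b / \<mu>))" if t: "t \<in> {t0..T}" for t
  proof -
    have "integral {0..t0} ?S + integral {t0..t} ?S = integral {0..t} ?S"
      by (rule Henstock_Kurzweil_Integration.integral_combine) (use t t0 iS in auto)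
    moreover have "integral {t0..t} ?S = integral {t0..t} (\<lambda>s. - (\<mu> * (?I s - b / \<mu>)))"
    proof (rule Henstock_Kurzweil_Integration.integral_cong)
      fix s assume s: "s \<in> {t0..t}"
      \<comment> \<open>After the entry time newcomers are behind the characteristic, so the inflow
        counts in full.\<close>
      then have "- s \<le> c" by (auto simp: t0_def)
      then show "?S s = - (\<mu> * (?I s - b / \<mu>))"
        using J[of s] s t \<mu> by (simp add: transport_source_def field_simps)
    qed
    moreover have "?I t = ?I t0 + (integral {0..t} ?S - integral {0..t0} ?S)"
      using mild[of t] mild[of t0] t t0 by simp
    ultimately show ?thesis by simp
  qed
  then have e: "?I T - b / \<mu> = (?I t0 - b / \<mu>) * exp (- integral {t0..T} (\<lambda>_. \<mu>))"
    by (intro linear_ode_solution t0 continuous_intros cI)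
  have e1: "integral {t0..T} (\<lambda>_. \<mu>) = \<mu> * min T q"
    using t0 by (auto simp: t0_def c_def min_def max_def)
  have e2: "?I T = (LINT s:{0..q}|lebesgue. f T s)"
    by (simp add: transport_pairing_atMost c_def)
  show ?thesis using e[unfolded e1 e2 I0] unfolding c_def by linarith
qed

text \<open>The case \<open>q = 0\<close> is the coupled system, where \<open>k = C / A\<close>. When \<open>k\<close> is prescribed instead, as in the
  construction of a solution, \<open>k A = C\<close> is not known beforehand and \<open>q = k\<close>.\<close>

lemma mass_conservation:
  assumes w: "weak_solution (\<lambda>t s. \<mu> + k t * indicator {\<tau>..} s) (\<mu> * N + C) f\<^sub>0 f" and \<tau>: "\<tau> \<ge> 0"
    and k: "continuous_on {0..} k" and f0: "f\<^sub>0 absolutely_integrable_on {0..}" "(LINT s:{0..}|lebesgue. f\<^sub>0 s) = N"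
    and flux: "\<And>t. t \<ge> 0 \<Longrightarrow> k t * (LINT s:{\<tau>..}|lebesgue. f t s) = C + q t * ((LINT s:{0..}|lebesgue. f t s) - N)"
    and q: "continuous_on {0..} q" and T: "T \<ge> 0"
  shows "(LINT s:{0..}|lebesgue. f T s) = N"
proof -
  have f: "continuous_L1 f" using w by (simp add: weak_solution_def)
  let ?M = "transport_pairing f 0 (\<lambda>_. 1)"
  have M: "transport_pairing f a (\<lambda>_. 1) t = (LINT s:{a..}|lebesgue. f t s)" for a t
    by (simp add: transport_pairing_def)
  have cM: "continuous_on {0..T} ?M"
    by (rule continuous_on_subset[OF transport_pairing_continuous[OF f order.refl, of _ 1 "{}"]]) auto
  \<comment> \<open>The inflow \<open>\<mu> * N + C\<close> balances turnover and promotion exactly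
    at total mass \<open>N\<close>, so the equation for the deviation is homogeneous.\<close>
  have eq: "?M t - N = 0 - integral {0..t} (\<lambda>s. (\<mu> + q s) * (?M s - N))" if t: "t \<in> {0..T}" for t
  proof -
    have "?M t = N + integral {0..t} (transport_source (\<mu> * N + C) \<mu> k \<tau> f (\<lambda>_. 1))"
      using weak_solution_mild_1[OF w \<tau> k f0(1), of t] t f0(2) by simp
    also have "integral {0..t} (transport_source (\<mu> * N + C) \<mu> k \<tau> f (\<lambda>_. 1)) = integral {0..t} (\<lambda>s. - ((\<mu> + q s) * (?M s - N)))"
    proof (rule Henstock_Kurzweil_Integration.integral_cong)
      fix s assume "s \<in> {0..t}"
      then show "transport_source (\<mu> * N + C) \<mu> k \<tau> f (\<lambda>_. 1) s = - ((\<mu> + q s) * (?M s - N))"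
        using flux[of s] by (simp add: transport_source_def M algebra_simps)
    qed
    finally show ?thesis by simp
  qed
  have "?M T - N = 0 * exp (- integral {0..T} (\<lambda>s. \<mu> + q s))"
    by (rule linear_ode_solution[OF T _ _ eq]) (intro continuous_intros cM continuous_on_subset[OF q]; auto)+
  then show ?thesis by (simp add: M)
qed

lemma AE_eq_if_integrals_Icc_eq:
  fixes u v :: "real \<Rightarrow> real"
  assumes u: "u absolutely_integrable_on {0..}" and v: "v absolutely_integrable_on {0..}"
    and eq: "\<And>q. q \<ge> 0 \<Longrightarrow> (LINT s:{0..q}|lebesgue. u s) = (LINT s:{0..q}|lebesgue. v s)"
  shows "AE s in lebesgue. s \<ge> 0 \<longrightarrow> u s = v s"
proof -
  have sub: "h absolutely_integrable_on {0..q}" if "h absolutely_integrable_on {0..}" for h :: "real \<Rightarrow> real" and q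
    by (rule set_integrable_subset[OF that]) auto
  have "AE s in lebesgue. s \<ge> 0 \<longrightarrow> u s - v s = 0"
  proof (rule AE_zero_if_integrals_Icc_zero)
    show "(\<lambda>s. u s - v s) absolutely_integrable_on {0..}" using u v by (rule set_integral_diff(1))
    show "(LINT s:{0..q}|lebesgue. u s - v s) = 0" if "q \<ge> 0" for q
      using eq[OF that] set_integral_diff(2)[OF sub[OF u] sub[OF v]] by simp
  qed
  then show ?thesis by eventually_elim simp
qed

text \<open>Below the threshold the explicit mass formula determines the density. Above it, the
  difference of two solutions satisfies a homogeneous linear equation behind every characteristic,
  with zero initial value because the initial data agree.\<close>

lemma weak_solution_unique:
  assumes w: "weak_solution (\<lambda>t s. \<mu> + k t * indicator {\<tau>..} s) b f\<^sub>0 f"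
    and w': "weak_solution (\<lambda>t s. \<mu> + k t * indicator {\<tau>..} s) b f\<^sub>0 f'" and \<tau>: "\<tau> \<ge> 0"
    and k: "continuous_on {0..} k" and f0: "f\<^sub>0 absolutely_integrable_on {0..}" and \<mu>: "\<mu> > 0" and T: "T \<ge> 0"
  shows "eq_L1 (f T) (f' T)"
proof -
  have f: "continuous_L1 f" "continuous_L1 f'" using w w' by (auto simp: weak_solution_def)
  note fi = continuous_L1_integrable[OF f(1) _ order.refl] continuous_L1_integrable[OF f(2) _ order.refl]
  have below: "AE s in lebesgue. 0 \<le> s \<and> s \<le> \<tau> \<longrightarrow> f t s = f' t s" if t: "t \<ge> 0" for t
  proof -
    \<comment> \<open>Cutting off at \<open>\<tau>\<close> lets equality of the masses up to
      \<open>q \<le> \<tau>\<close> serve for every \<open>q\<close>, as the comparison of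
      cumulative integrals requires.\<close>
    have cut: "(LINT s:{0..q}|lebesgue. h s * indicator {..\<tau>} s) = (LINT s:{0..min q \<tau>}|lebesgue. h s)" for h :: "real \<Rightarrow> real" and q
      unfolding set_lebesgue_integral_def
      by (rule Bochner_Integration.integral_cong) (auto split: split_indicator)
    have i: "(\<lambda>s. h s * indicator {..\<tau>} s) absolutely_integrable_on {0..}" if "h absolutely_integrable_on {0..}" for h :: "real \<Rightarrow> real"
      by (rule absolutely_integrable_times_bounded_borel[OF that, where B=1])
         (auto intro!: borel_measurable_indicator split: split_indicator)
    have "AE s in lebesgue. s \<ge> 0 \<longrightarrow> f t s * indicator {..\<tau>} s = f' t s * indicator {..\<tau>} s"
    proof (rule AE_eq_if_integrals_Icc_eq[OF i[OF fi(1)[OF t]] i[OF fi(2)[OF t]]])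
      fix q :: real assume "q \<ge> 0"
      then have q: "0 \<le> min q \<tau>" "min q \<tau> \<le> \<tau>" using \<tau> by auto
      show "(LINT s:{0..q}|lebesgue. f t s * indicator {..\<tau>} s) = (LINT s:{0..q}|lebesgue. f' t s * indicator {..\<tau>} s)"
        unfolding cut mass_below_threshold[OF w \<tau> k f0 t q \<mu>] mass_below_threshold[OF w' \<tau> k f0 t q \<mu>] ..
    qed
    then show ?thesis by eventually_elim (auto split: split_indicator_asm)
  qed
  have eq: "(LINT s:{0..q}|lebesgue. f T s) = (LINT s:{0..q}|lebesgue. f' T s)" for q
  proof -
    let ?g = "indicator {..q - T} :: real \<Rightarrow> real"
    let ?I = "transport_pairing f 0 ?g" and ?I' = "transport_pairing f' 0 ?g"
    let ?J = "transport_pairing f \<tau> ?g" and ?J' = "transport_pairing f' \<tau> ?g"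
    let ?S = "transport_source b \<mu> k \<tau> f ?g" and ?S' = "transport_source b \<mu> k \<tau> f' ?g"
    \<comment> \<open>The part of the difference below \<open>\<tau>\<close> vanishes. This replaces
      the pairings over \<open>{\<tau>..}\<close> by those over \<open>{0..}\<close> and closes the
      equation.\<close>
    have IJ: "?I t - ?I' t = ?J t - ?J' t" if t: "t \<ge> 0" for t
    proof -
      have p: "(\<lambda>s. h t s * ?g (s - t)) absolutely_integrable_on {a..}" if "continuous_L1 h" "a \<ge> 0" for h a
        by (rule transport_integrable[OF that(1) t that(2), where B=1]) (auto split: split_indicator)
      let ?d = "\<lambda>s. f t s * ?g (s - t) - f' t s * ?g (s - t)"
      have "?I t - ?I' t = (LINT s:{0..}|lebesgue. ?d s)"
        unfolding transport_pairing_def by (intro set_integral_diff(2)[symmetric] p f order.refl)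
      also have "\<dots> = (LINT s:{\<tau>..}|lebesgue. ?d s)"
        unfolding set_lebesgue_integral_def
      proof (rule integral_cong_AE)
        show "AE s in lebesgue. indicator {0..} s *\<^sub>R ?d s = indicator {\<tau>..} s *\<^sub>R ?d s"
          using below[OF t] by eventually_elim (use \<tau> in \<open>auto split: split_indicator\<close>)
      qed (intro borel_measurable_integrable set_integral_diff(1)[OF p p, unfolded set_integrable_def] f \<tau> order.refl)+
      also have "\<dots> = ?J t - ?J' t"
        unfolding transport_pairing_def by (intro set_integral_diff(2) p f \<tau>)
      finally show ?thesis .
    qed
    have iS: "transport_source b \<mu> k \<tau> h ?g integrable_on {0..t}" if "continuous_L1 h" for h t
      by (rule set_lebesgue_integral_eq_integral(1)[OF transport_source_atMost_integrable[OF that \<tau> k]])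
    have "?I t - ?I' t = 0 - integral {0..t} (\<lambda>s. (\<mu> + k s) * (?I s - ?I' s))" if t: "t \<in> {0..T}" for t
    proof -
      have t0: "t \<ge> 0" using t by simp
      have "?I t - ?I' t = integral {0..t} ?S - integral {0..t} ?S'"
        unfolding weak_solution_mild_atMost[OF w \<tau> k f0 t0] weak_solution_mild_atMost[OF w' \<tau> k f0 t0] by simp
      also have "\<dots> = integral {0..t} (\<lambda>s. ?S s - ?S' s)"
        by (rule Henstock_Kurzweil_Integration.integral_diff[symmetric]) (intro iS f)+
      also have "\<dots> = integral {0..t} (\<lambda>s. - ((\<mu> + k s) * (?I s - ?I' s)))"
      proof (rule Henstock_Kurzweil_Integration.integral_cong)
        fix s assume "s \<in> {0..t}"
        then have "?I s - ?I' s = ?J s - ?J' s" by (intro IJ) simp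
        moreover have "?S s - ?S' s = - (\<mu> * (?I s - ?I' s)) - k s * (?J s - ?J' s)"
          by (simp add: transport_source_def algebra_simps)
        ultimately have "?S s - ?S' s = - (\<mu> * (?I s - ?I' s)) - k s * (?I s - ?I' s)" by simp
        then show "?S s - ?S' s = - ((\<mu> + k s) * (?I s - ?I' s))" by (simp add: algebra_simps)
      qed
      finally show ?thesis by simp
    qed
    then have "?I T - ?I' T = 0 * exp (- integral {0..T} (\<lambda>s. \<mu> + k s))"
      by (intro linear_ode_solution[OF T] continuous_intros continuous_on_subset[OF k]
         continuous_on_subset[OF transport_pairing_atMost_continuous[OF f(1) order.refl]]
         continuous_on_subset[OF transport_pairing_atMost_continuous[OF f(2) order.refl]]) auto
    then show ?thesis by (simp add: transport_pairing_atMost)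
  qed
  show ?thesis unfolding eq_L1_def by (rule AE_eq_if_integrals_Icc_eq[OF fi(1)[OF T] fi(2)[OF T] eq])
qed

subsection \<open>Continuity of translations in the integral norm\<close>

text \<open>An antiderivative on the whole line gives the cumulative promotion rate an ordinary
  derivative at every time, without one-sided derivatives at 0.\<close>

lemma antiderivative_real:
  fixes k :: "real \<Rightarrow> real"
  assumes "continuous_on UNIV k"
  obtains K where "\<And>t. (K has_real_derivative k t) (at t)"
proof -
  have "\<exists>F. \<forall>x::real. -\<infinity> < ereal x \<longrightarrow> ereal x < \<infinity> \<longrightarrow> (F has_vector_derivative k x) (at x)"
    by (rule einterval_antiderivative) (use assms in \<open>auto simp: continuous_on_eq_continuous_at\<close>)
  then show ?thesis using that by (auto simp: has_real_derivative_iff_has_vector_derivative)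
qed

lemma translation_diff_integrable:
  fixes u v :: "real \<Rightarrow> real"
  assumes "integrable lborel u" "integrable lborel v"
  shows "integrable lborel (\<lambda>x. \<bar>u (x - h) - v x\<bar>)" "integrable lborel (\<lambda>x. u (x - h))"
    "(LINT x|lborel. u (x - h)) = (LINT x|lborel. u x)"
proof -
  show i: "integrable lborel (\<lambda>x. u (x - h))"
    using lborel_integrable_real_affine[OF assms(1), of 1 "- h"] by (simp add: algebra_simps)
  then show "integrable lborel (\<lambda>x. \<bar>u (x - h) - v x\<bar>)" using assms by auto
  show "(LINT x|lborel. u (x - h)) = (LINT x|lborel. u x)"
    using lborel_integral_real_affine[of 1 u "- h"] by (simp add: algebra_simps)
qed

text \<open>The factor 2 comes from translation invariance: the shifted and the unshifted
  approximation error have the same integral.\<close>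

lemma translation_diff_triangle:
  fixes u v :: "real \<Rightarrow> real"
  assumes u: "integrable lborel u" and v: "integrable lborel v"
  shows "(LINT x|lborel. \<bar>u (x - h) - u x\<bar>) \<le> (LINT x|lborel. \<bar>v (x - h) - v x\<bar>) + 2 * (LINT x|lborel. \<bar>u x - v x\<bar>)"
proof -
  have d: "integrable lborel (\<lambda>x. \<bar>u x - v x\<bar>)" using u v by auto
  note t = translation_diff_integrable[where h=h]
  have "(LINT x|lborel. \<bar>u (x - h) - u x\<bar>) \<le> (LINT x|lborel. \<bar>v (x - h) - v x\<bar> + (\<bar>u (x - h) - v (x - h)\<bar> + \<bar>u x - v x\<bar>))"
    by (intro integral_mono Bochner_Integration.integrable_add t(1)[OF v v] t(2)[OF d d] d t(1)[OF u u]) auto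
  also have "\<dots> = (LINT x|lborel. \<bar>v (x - h) - v x\<bar>) + ((LINT x|lborel. \<bar>u (x - h) - v (x - h)\<bar>) + (LINT x|lborel. \<bar>u x - v x\<bar>))"
    by (subst Bochner_Integration.integral_add, rule t[OF v v], rule Bochner_Integration.integrable_add[OF t(2)[OF d d] d],
        subst Bochner_Integration.integral_add, rule t(2)[OF d d], rule d, rule refl)
  also have "(LINT x|lborel. \<bar>u (x - h) - v (x - h)\<bar>) = (LINT x|lborel. \<bar>u x - v x\<bar>)" by (rule t(3)[OF d d])
  finally show ?thesis by simp
qed

lemma tendsto_zero_approx:
  fixes a :: "nat \<Rightarrow> real"
  assumes "\<And>n. 0 \<le> a n" and "\<And>e. e > 0 \<Longrightarrow> \<exists>b. b \<longlonglongrightarrow> 0 \<and> (\<forall>n. a n \<le> b n + e)"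
  shows "a \<longlonglongrightarrow> 0"
proof (rule LIMSEQ_I)
  fix e :: real assume "e > 0"
  then obtain b where b: "b \<longlonglongrightarrow> 0" "\<And>n. a n \<le> b n + e / 2" using assms(2)[of "e / 2"] by auto
  obtain m where m: "\<And>n. n \<ge> m \<Longrightarrow> \<bar>b n\<bar> < e / 2" using LIMSEQ_D[OF b(1), of "e / 2"] \<open>e > 0\<close> by auto
  have "norm (a n - 0) < e" if "n \<ge> m" for n
    using b(2)[of n] m[OF that] assms(1)[of n] by simp
  then show "\<exists>m. \<forall>n\<ge>m. norm (a n - 0) < e" by blast
qed

text \<open>An absolute difference is twice a positive part plus a signed difference, and the signed
  difference integrates to 0 by translation invariance. The positive part is dominated by the
  indicator of \<open>U\<close> and tends to 0 because \<open>U\<close> is open. The absolute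
  difference itself has no such evident dominating function.\<close>

lemma translation_continuous_open:
  fixes U :: "real set"
  assumes U: "open U" "emeasure lborel U < \<infinity>" and h: "h \<longlonglongrightarrow> 0"
  shows "(\<lambda>n. LINT x|lborel. \<bar>indicator U (x - h n) - indicator U x\<bar> :: real) \<longlonglongrightarrow> 0"
proof -
  have U': "U \<in> sets borel" using U(1) by simp
  have i: "integrable lborel (indicator U :: real \<Rightarrow> real)" using U by (intro integrable_real_indicator) auto
  let ?p = "\<lambda>n x. max 0 (indicator U x - indicator U (x - h n)) :: real"
  note t = translation_diff_integrable[OF i i]
  have ip: "integrable lborel (?p n)" for n using t(2)[of "h n"] i by auto
  have eq: "(LINT x|lborel. \<bar>indicator U (x - h n) - indicator U x\<bar> :: real) = 2 * (LINT x|lborel. ?p n x)" for n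
  proof -
    have "(LINT x|lborel. \<bar>indicator U (x - h n) - indicator U x\<bar> :: real)
      = (LINT x|lborel. 2 * ?p n x + (indicator U (x - h n) - indicator U x))"
      by (rule Bochner_Integration.integral_cong) (auto split: split_indicator)
    also have "\<dots> = 2 * (LINT x|lborel. ?p n x)"
      using ip t i by simp
    finally show ?thesis .
  qed
  have "(\<lambda>n. LINT x|lborel. ?p n x) \<longlonglongrightarrow> (LINT x::real|lborel. 0 :: real)"
  proof (rule integral_dominated_convergence[where w="indicator U"])
    have "(\<lambda>n. ?p n x) \<longlonglongrightarrow> 0" for x
    proof (cases "x \<in> U")
      case True
      have "(\<lambda>n. x - h n) \<longlonglongrightarrow> x" using tendsto_diff[OF tendsto_const h, of x] by simp
      from topological_tendstoD[OF this U(1) True] have "\<forall>\<^sub>F n in sequentially. ?p n x = 0"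
        by eventually_elim (use True in simp)
      then show ?thesis by (rule tendsto_eventually)
    next
      case False
      then have "?p n x = 0" for n by (simp split: split_indicator)
      then show ?thesis by simp
    qed
    then show "AE x in lborel. (\<lambda>n. ?p n x) \<longlonglongrightarrow> 0" by simp
  qed (use i ip in \<open>auto split: split_indicator intro: borel_measurable_integrable\<close>)
  then show ?thesis unfolding eq using tendsto_mult_right_zero by fastforce
qed

text \<open>Density argument: outer regularity reduces Borel sets of finite measure to open sets,
  and the property passes to sums and to dominated limits.\<close>

lemma translation_continuous_L1:
  fixes u :: "real \<Rightarrow> real"
  assumes "integrable lborel u" and h: "h \<longlonglongrightarrow> 0"
  shows "(\<lambda>n. LINT x|lborel. \<bar>u (x - h n) - u x\<bar>) \<longlonglongrightarrow> 0"
  using assms(1)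
proof (induction rule: integrable_induct)
  case (base A c)
  have A: "A \<in> sets borel" using base by simp
  let ?I = "\<lambda>A x. indicator A x *\<^sub>R c :: real"
  have iA: "integrable lborel (?I A)" using base by (intro integrable_scaleR_left integrable_real_indicator)
  show ?case
  proof (rule tendsto_zero_approx)
    fix e :: real assume e: "e > 0"
    \<comment> \<open>Chosen so that \<open>2 * (d * \<bar>c\<bar>) \<le> e\<close>; adding 1 covers
      \<open>c = 0\<close>.\<close>
    define d where "d = e / (2 * (\<bar>c\<bar> + 1))"
    have d: "d > 0" using e by (simp add: d_def)
    obtain U where U: "open U" "A \<subseteq> U" "emeasure lborel (U - A) < d" by (rule outer_regular_lborel[OF A d])
    have "emeasure lborel U \<le> emeasure lborel A + emeasure lborel (U - A)"
      using U A by (subst plus_emeasure) (auto intro!: emeasure_mono)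
    also have "\<dots> < \<infinity>" using base(2) U(3) by (auto simp: less_top[symmetric] intro: less_trans)
    finally have Uf: "emeasure lborel U < \<infinity>" .
    have iU: "integrable lborel (?I U)" using U Uf by (intro integrable_scaleR_left integrable_real_indicator) auto
    have mU: "measure lborel (U - A) \<le> d"
      using U(3) d by (simp add: measure_def enn2real_leI less_imp_le)
    have "(LINT x|lborel. \<bar>?I A x - ?I U x\<bar>) = (LINT x|lborel. indicator (U - A) x * \<bar>c\<bar>)"
      by (rule Bochner_Integration.integral_cong) (use U(2) in \<open>auto split: split_indicator\<close>)
    also have "\<dots> = measure lborel (U - A) * \<bar>c\<bar>" using U A by simp
    also have "2 * \<dots> \<le> 2 * (d * \<bar>c\<bar>)" using mU by (intro mult_left_mono mult_right_mono) auto
    also have "\<dots> \<le> e" using e by (simp add: d_def field_simps)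
    finally have small: "2 * (LINT x|lborel. \<bar>?I A x - ?I U x\<bar>) \<le> e" .
    have "(LINT x|lborel. \<bar>?I U (x - h n) - ?I U x\<bar>) = \<bar>c\<bar> * (LINT x|lborel. \<bar>indicator U (x - h n) - indicator U x\<bar>)" for n
      unfolding integral_mult_right_zero[symmetric]
      by (rule Bochner_Integration.integral_cong) (auto split: split_indicator)
    then have "(\<lambda>n. LINT x|lborel. \<bar>?I U (x - h n) - ?I U x\<bar>) \<longlonglongrightarrow> 0"
      using tendsto_mult_right_zero[OF translation_continuous_open[OF U(1) Uf h]] by simp
    moreover have "(LINT x|lborel. \<bar>?I A (x - h n) - ?I A x\<bar>) \<le> (LINT x|lborel. \<bar>?I U (x - h n) - ?I U x\<bar>) + e" for n
      using translation_diff_triangle[OF iA iU, of "h n"] small by linarith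
    ultimately show "\<exists>b. b \<longlonglongrightarrow> 0 \<and> (\<forall>n. (LINT x|lborel. \<bar>?I A (x - h n) - ?I A x\<bar>) \<le> b n + e)" by blast
  qed simp
next
  case (add f g)
  show ?case
  proof (rule tendsto_sandwich[OF _ _ tendsto_const])
    show "(\<lambda>n. (LINT x|lborel. \<bar>f (x - h n) - f x\<bar>) + (LINT x|lborel. \<bar>g (x - h n) - g x\<bar>)) \<longlonglongrightarrow> 0"
      using tendsto_add[OF add(3,4)] by simp
    show "\<forall>\<^sub>F n in sequentially. (LINT x|lborel. \<bar>f (x - h n) + g (x - h n) - (f x + g x)\<bar>)
       \<le> (LINT x|lborel. \<bar>f (x - h n) - f x\<bar>) + (LINT x|lborel. \<bar>g (x - h n) - g x\<bar>)"
    proof (intro always_eventually allI)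
      fix n
      note tf = translation_diff_integrable[OF add(1,1), of "h n"] and tg = translation_diff_integrable[OF add(2,2), of "h n"]
      have s: "integrable lborel (\<lambda>x. f x + g x)" using add by auto
      have "(LINT x|lborel. \<bar>f (x - h n) + g (x - h n) - (f x + g x)\<bar>) \<le> (LINT x|lborel. \<bar>f (x - h n) - f x\<bar> + \<bar>g (x - h n) - g x\<bar>)"
        by (rule integral_mono[OF translation_diff_integrable(1)[OF s s] Bochner_Integration.integrable_add[OF tf(1) tg(1)]]) linarith
      then show "(LINT x|lborel. \<bar>f (x - h n) + g (x - h n) - (f x + g x)\<bar>)
       \<le> (LINT x|lborel. \<bar>f (x - h n) - f x\<bar>) + (LINT x|lborel. \<bar>g (x - h n) - g x\<bar>)"
        using tf tg by simp
    qed
  qed simp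
next
  case (lim f s)
  have 0: "(\<lambda>i. LINT x|lborel. \<bar>f x - s i x\<bar>) \<longlonglongrightarrow> (LINT x::real|lborel. (0::real))"
  \<comment> \<open>The approximants satisfy
    \<open>\<bar>s i x\<bar> \<le> 2 * \<bar>f x\<bar>\<close>, and the difference costs one more
    multiple.\<close>
  proof (rule integral_dominated_convergence[where w="\<lambda>x. 3 * \<bar>f x\<bar>"])
    have "(\<lambda>i. \<bar>f x - s i x\<bar>) \<longlonglongrightarrow> \<bar>f x - f x\<bar>" for x
      by (intro tendsto_intros lim(2)) simp
    then show "AE x in lborel. (\<lambda>i. \<bar>f x - s i x\<bar>) \<longlonglongrightarrow> 0" by simp
    have "norm \<bar>f x - s i x\<bar> \<le> 3 * \<bar>f x\<bar>" for i x using lim(3)[of x i] by simp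
    then show "AE x in lborel. norm \<bar>f x - s i x\<bar> \<le> 3 * \<bar>f x\<bar>" for i by simp
    show "integrable lborel (\<lambda>x. 3 * \<bar>f x\<bar>)" using lim(4) by auto
    show "(\<lambda>x. \<bar>f x - s i x\<bar>) \<in> borel_measurable lborel" for i
      using borel_measurable_integrable[OF lim(4)] borel_measurable_integrable[OF lim(1)] by measurable
  qed simp
  show ?case
  proof (rule tendsto_zero_approx)
    fix e :: real assume e: "e > 0"
    then obtain i where "\<bar>LINT x|lborel. \<bar>f x - s i x\<bar>\<bar> < e / 2"
      using LIMSEQ_D[OF 0, of "e / 2"] by auto
    then have "2 * (LINT x|lborel. \<bar>f x - s i x\<bar>) \<le> e" by linarith
    then have "(LINT x|lborel. \<bar>f (x - h n) - f x\<bar>) \<le> (LINT x|lborel. \<bar>s i (x - h n) - s i x\<bar>) + e" for n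
      using translation_diff_triangle[OF lim(4) lim(1), of "h n" i] by linarith
    with lim(5) show "\<exists>b. b \<longlonglongrightarrow> 0 \<and> (\<forall>n. (LINT x|lborel. \<bar>f (x - h n) - f x\<bar>) \<le> b n + e)" by blast
  qed simp
qed

subsection \<open>Integration along characteristics\<close>

text \<open>\<open>u\<close> encodes the data by the value \<open>s - t\<close> at which a characteristic enters the quadrant:
  initial data for \<open>s - t \<ge> 0\<close>, boundary data for \<open>s - t < 0\<close>.\<close>

locale characteristics =
  fixes \<mu> \<tau> b :: real and k K u :: "real \<Rightarrow> real"
  assumes \<mu>: "\<mu> > 0" and \<tau>: "\<tau> \<ge> 0"
    and k_continuous: "continuous_on UNIV k" and k_nonneg: "k t \<ge> 0"
    and K: "(K has_real_derivative k t) (at t)"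
    and u_measurable [measurable]: "u \<in> borel_measurable borel"
    and u_integrable: "set_integrable lborel {0..} u" and u_negative: "x < 0 \<Longrightarrow> u x = b"
begin

text \<open>The fraction left at time \<open>t\<close> of the cohort \<open>x = s - t\<close>. It
  enters at time \<open>max 0 (- x)\<close> and becomes eligible at time
  \<open>max 0 (\<tau> - x)\<close>; the outer \<open>max\<close> and \<open>min\<close> switch off
  turnover and promotion before these times, which keeps the formula continuous everywhere.\<close>

definition survival :: "real \<Rightarrow> real \<Rightarrow> real" where
  "survival t x = exp (- (\<mu> * max 0 (t - max 0 (- x)) + (K t - K (min t (max 0 (\<tau> - x))))))"

definition solution :: "real \<Rightarrow> real \<Rightarrow> real" where
  "solution t s = u (s - t) * survival t (s - t)"

lemma K_mono: "s \<le> t \<Longrightarrow> K s \<le> K t"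
  by (rule DERIV_nonneg_imp_nondecreasing[of s t K]) (use K k_nonneg in blast)+

lemma K_continuous: "continuous_on S K"
  by (intro continuous_at_imp_continuous_on ballI DERIV_isCont[OF K])

lemma survival_bounds: "0 < survival t x" "survival t x \<le> 1"
proof -
  have "K (min t (max 0 (\<tau> - x))) \<le> K t" by (rule K_mono) simp
  moreover have "\<mu> * max 0 (t - max 0 (- x)) \<ge> 0" using \<mu> by simp
  ultimately show "survival t x \<le> 1" by (simp add: survival_def)
qed (simp add: survival_def)

lemma survival_continuous: "continuous_on S (\<lambda>p. survival (fst p) (snd p))"
  unfolding survival_def by (intro continuous_intros continuous_on_compose2[OF K_continuous[of UNIV]]) auto

lemma survival_measurable [measurable]:
  assumes [measurable]: "f \<in> borel_measurable M" "g \<in> borel_measurable M"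
  shows "(\<lambda>x. survival (f x) (g x)) \<in> borel_measurable M"
proof -
  have "(\<lambda>p. survival (fst p) (snd p)) \<in> borel_measurable (borel \<Otimes>\<^sub>M borel)"
    by (simp add: borel_prod borel_measurable_continuous_onI survival_continuous)
  from measurable_compose[OF measurable_Pair[OF assms] this] show ?thesis by simp
qed

text \<open>The data \<open>u\<close> equal \<open>b\<close> on the whole negative axis and need not
  be integrable. Up to time \<open>R\<close> only cohorts with \<open>x \<ge> - R\<close> have
  entered, so this truncation loses nothing.\<close>

definition truncated :: "real \<Rightarrow> real \<Rightarrow> real" where "truncated R x = indicator {- R..} x * u x"

lemma truncated_integrable: "integrable lborel (truncated R)"
proof -
  \<comment> \<open>The last term is nonzero only for \<open>R < 0\<close>, where the truncation
    also removes initial data.\<close>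
  have "integrable lborel (\<lambda>x. indicator {0..} x * u x + b * indicator {- R..<0} x - indicator {0..<-R} x * (indicator {0..} x * u x))"
  proof (intro Bochner_Integration.integrable_add Bochner_Integration.integrable_diff)
    show i: "integrable lborel (\<lambda>x. indicator {0..} x * u x)" using u_integrable by (simp add: set_integrable_def)
    show "integrable lborel (\<lambda>x. b * indicator {- R..<0} x)"
      by (intro integrable_mult_right integrable_real_indicator emeasure_bounded_finite
          bounded_subset[OF bounded_closed_interval[of "- R" 0]]) auto
    show "integrable lborel (\<lambda>x. indicator {0..<-R} x * (indicator {0..} x * u x))"
      using integrable_mult_indicator[OF _ i, of "{0..<-R}"] by simp
  qed
  also have "(\<lambda>x. indicator {0..} x * u x + b * indicator {- R..<0} x - indicator {0..<-R} x * (indicator {0..} x * u x)) = truncated R"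
    using u_negative by (auto simp: truncated_def fun_eq_iff split: split_indicator)
  finally show ?thesis .
qed

lemma truncated_survival_integrable: "integrable lborel (\<lambda>x. truncated R x * survival t x)"
proof (rule Bochner_Integration.integrable_bound[OF truncated_integrable])
  show "(\<lambda>x. truncated R x * survival t x) \<in> borel_measurable lborel" unfolding truncated_def by measurable
  show "AE x in lborel. norm (truncated R x * survival t x) \<le> norm (truncated R x)"
    using survival_bounds by (simp add: abs_mult mult_left_le less_imp_le)
qed

lemma solution_measurable [measurable]: "solution t \<in> borel_measurable borel"
  unfolding solution_def[abs_def] by measurable

lemma solution_integrable: "solution t absolutely_integrable_on {0..}"
proof -
  have "integrable lborel (\<lambda>s. truncated t (s - t) * survival t (s - t))"
    using translation_diff_integrable(2)[OF truncated_survival_integrable truncated_survival_integrable] .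
  also have "(\<lambda>s. truncated t (s - t) * survival t (s - t)) = (\<lambda>s. indicator {0..} s *\<^sub>R solution t s)"
    by (auto simp: fun_eq_iff truncated_def solution_def split: split_indicator)
  finally show ?thesis unfolding set_integrable_def by (subst integrable_completion) auto
qed

text \<open>A time increment moves the data, which is small by L1 continuity of translations, and
  changes the survival factor, which is small by dominated convergence.\<close>

lemma solution_continuous_L1: "continuous_L1 solution"
  unfolding continuous_L1_def
proof (intro conjI allI impI)
  show "solution t absolutely_integrable_on {0..}" for t by (rule solution_integrable)
  fix t0 :: real assume t0: "0 \<le> t0"
  show "((\<lambda>t. LINT s:{0..}|lebesgue. \<bar>solution t s - solution t0 s\<bar>) \<longlongrightarrow> 0) (at t0 within {0..})"
    unfolding tendsto_at_iff_sequentially comp_def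
  proof (intro allI impI)
    fix X :: "nat \<Rightarrow> real" assume X0: "\<forall>i. X i \<in> {0..} - {t0}" and X: "X \<longlonglongrightarrow> t0"
    \<comment> \<open>A convergent sequence of times is bounded, so one truncation serves for all of
      them.\<close>
    obtain R where R: "\<And>n. X n \<le> R" "t0 \<le> R"
    proof -
      obtain B where "\<And>n. norm (X n) \<le> B" using convergent_imp_Bseq[OF convergentI[OF X]] by (auto simp: Bseq_def)
      then have "X n \<le> max B t0" for n by (metis abs_ge_self max.coboundedI1 order.trans real_norm_def)
      then show ?thesis by (intro that[of "max B t0"]) auto
    qed
    let ?U = "truncated R"
    let ?D1 = "\<lambda>n s. \<bar>?U (s - X n) - ?U (s - t0)\<bar>"
    let ?D2 = "\<lambda>n s. \<bar>?U (s - t0)\<bar> * \<bar>survival (X n) (s - X n) - survival t0 (s - t0)\<bar>"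
    have iU: "integrable lborel (\<lambda>s. ?U (s - r))" for r
      by (rule translation_diff_integrable(2)[OF truncated_integrable truncated_integrable])
    have i1: "integrable lborel (?D1 n)" for n using iU by auto
    have [measurable]: "truncated R \<in> borel_measurable borel" unfolding truncated_def[abs_def] by measurable
    have b2: "?D2 n s \<le> 2 * \<bar>?U (s - t0)\<bar>" for n s
    proof -
      have "\<bar>survival (X n) (s - X n) - survival t0 (s - t0)\<bar> \<le> 2"
        using survival_bounds[of "X n" "s - X n"] survival_bounds[of t0 "s - t0"] by linarith
      then show ?thesis by (metis abs_ge_zero mult.commute mult_right_mono)
    qed
    have i2: "integrable lborel (?D2 n)" for n
    proof (rule Bochner_Integration.integrable_bound)
      show "integrable lborel (\<lambda>s. 2 * \<bar>?U (s - t0)\<bar>)" using iU by auto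
    qed (use b2 in \<open>auto simp: abs_mult\<close>)
    have 2: "(\<lambda>n. LINT s|lborel. ?D2 n s) \<longlonglongrightarrow> (LINT s::real|lborel. (0::real))"
    proof (rule integral_dominated_convergence[where w="\<lambda>s. 2 * \<bar>?U (s - t0)\<bar>"])
      have "(\<lambda>n. ?D2 n s) \<longlonglongrightarrow> 0" for s
      proof -
        have "(\<lambda>n. (X n, s - X n)) \<longlonglongrightarrow> (t0, s - t0)" by (intro tendsto_intros X)
        with survival_continuous[of UNIV] have "(\<lambda>n. survival (X n) (s - X n)) \<longlonglongrightarrow> survival t0 (s - t0)"
          using isCont_tendsto_compose[of "(t0, s - t0)" "\<lambda>p. survival (fst p) (snd p)"]
          by (fastforce simp: continuous_on_eq_continuous_at)
        from tendsto_mult_right_zero[OF tendsto_rabs_zero[OF LIM_zero[OF this]]] show ?thesis by simp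
      qed
      then show "AE s in lborel. (\<lambda>n. ?D2 n s) \<longlonglongrightarrow> 0" by simp
      show "AE s in lborel. norm (?D2 n s) \<le> 2 * \<bar>?U (s - t0)\<bar>" for n using b2 by (simp add: abs_mult)
      show "integrable lborel (\<lambda>s. 2 * \<bar>?U (s - t0)\<bar>)" using iU by auto
    qed auto
    have 1: "(\<lambda>n. LINT s|lborel. ?D1 n s) \<longlonglongrightarrow> 0"
    proof -
      have "(LINT s|lborel. ?D1 n s) = (LINT x|lborel. \<bar>?U (x - (X n - t0)) - ?U x\<bar>)" for n
        using lborel_integral_real_affine[of 1 "?D1 n" t0] by (simp add: algebra_simps)
      then show ?thesis using translation_continuous_L1[OF truncated_integrable LIM_zero[OF X], of R] by simp
    qed
    show "(\<lambda>n. LINT s:{0..}|lebesgue. \<bar>solution (X n) s - solution t0 s\<bar>) \<longlonglongrightarrow> 0"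
    proof (rule tendsto_sandwich[OF _ _ tendsto_const])
      show "(\<lambda>n. (LINT s|lborel. ?D1 n s) + (LINT s|lborel. ?D2 n s)) \<longlonglongrightarrow> 0"
        using tendsto_add[OF 1 2] by simp
      show "\<forall>\<^sub>F n in sequentially. 0 \<le> (LINT s:{0..}|lebesgue. \<bar>solution (X n) s - solution t0 s\<bar>)"
        by (intro always_eventually allI) (auto simp: set_lebesgue_integral_def intro!: Bochner_Integration.integral_nonneg)
      show "\<forall>\<^sub>F n in sequentially. (LINT s:{0..}|lebesgue. \<bar>solution (X n) s - solution t0 s\<bar>)
          \<le> (LINT s|lborel. ?D1 n s) + (LINT s|lborel. ?D2 n s)"
      proof (intro always_eventually allI)
        fix n
        have "(LINT s:{0..}|lebesgue. \<bar>solution (X n) s - solution t0 s\<bar>)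
          = (LINT s|lborel. indicator {0..} s *\<^sub>R \<bar>solution (X n) s - solution t0 s\<bar>)"
          unfolding set_lebesgue_integral_def by (rule integral_completion) measurable
        also have "\<dots> \<le> (LINT s|lborel. ?D1 n s + ?D2 n s)"
        proof (rule integral_mono)
          show "integrable lborel (\<lambda>s. indicator {0..} s *\<^sub>R \<bar>solution (X n) s - solution t0 s\<bar>)"
            using set_integrable_abs[OF set_integral_diff(1)[OF solution_integrable[of "X n"] solution_integrable[of t0]]]
            unfolding set_integrable_def by (subst (asm) integrable_completion) auto
          show "integrable lborel (\<lambda>s. ?D1 n s + ?D2 n s)" using i1 i2 by auto
          fix s
          show "indicator {0..} s *\<^sub>R \<bar>solution (X n) s - solution t0 s\<bar> \<le> ?D1 n s + ?D2 n s"
          proof (cases "s \<ge> 0")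
            case True
            let ?a = "survival (X n) (s - X n)" and ?c = "survival t0 (s - t0)"
            have e: "u (s - X n) = ?U (s - X n)" "u (s - t0) = ?U (s - t0)"
              using True R(1)[of n] R(2) by (simp_all add: truncated_def)
            have "solution (X n) s - solution t0 s = (?U (s - X n) - ?U (s - t0)) * ?a + ?U (s - t0) * (?a - ?c)"
              by (simp add: solution_def e algebra_simps)
            also have "\<bar>\<dots>\<bar> \<le> \<bar>(?U (s - X n) - ?U (s - t0)) * ?a\<bar> + ?D2 n s"
              by (rule order.trans[OF abs_triangle_ineq]) (simp add: abs_mult)
            also have "\<bar>(?U (s - X n) - ?U (s - t0)) * ?a\<bar> \<le> ?D1 n s"
              using survival_bounds[of "X n" "s - X n"] by (simp add: abs_mult mult_left_le)
            finally show ?thesis using True by simp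
          qed auto
        qed
        also have "\<dots> = (LINT s|lborel. ?D1 n s) + (LINT s|lborel. ?D2 n s)"
          by (rule Bochner_Integration.integral_add[OF i1 i2])
        finally show "(LINT s:{0..}|lebesgue. \<bar>solution (X n) s - solution t0 s\<bar>)
          \<le> (LINT s|lborel. ?D1 n s) + (LINT s|lborel. ?D2 n s)" .
      qed
    qed
  qed
qed

end

section \<open>Weak formulation of the constructed solution\<close>

lemma test_functionD:
  assumes "test_function \<phi> \<phi>t \<phi>s"
  shows "(\<phi> has_derivative (\<lambda>h. \<phi>t p * fst h + \<phi>s p * snd h)) (at p)"
    "continuous_on S \<phi>" "continuous_on S \<phi>t" "continuous_on S \<phi>s"
proof -
  show 1: "(\<phi> has_derivative (\<lambda>h. \<phi>t p * fst h + \<phi>s p * snd h)) (at p)" for p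
    using assms unfolding test_function_def by blast
  show "continuous_on S \<phi>"
    using has_derivative_continuous[OF 1] by (simp add: continuous_at_imp_continuous_on)
  show "continuous_on S \<phi>t" "continuous_on S \<phi>s"
    using assms by (auto simp: test_function_def intro: continuous_on_subset)
qed

lemma test_function_support:
  assumes t: "test_function \<phi> \<phi>t \<phi>s"
  obtains R M where "R > 0" "M \<ge> 0" "\<And>p. \<bar>\<phi> p\<bar> \<le> M" "\<And>p. \<bar>\<phi>t p\<bar> \<le> M" "\<And>p. \<bar>\<phi>s p\<bar> \<le> M"
    "\<And>t s. \<bar>t\<bar> > R \<or> \<bar>s\<bar> > R \<Longrightarrow> \<phi> (t, s) = 0 \<and> \<phi>t (t, s) = 0 \<and> \<phi>s (t, s) = 0"
proof -
  obtain C where C: "compact C" and z: "\<And>p. p \<notin> C \<Longrightarrow> \<phi> p = 0"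
    using t unfolding test_function_def by blast
  \<comment> \<open>The complement of the compact set is open and \<open>\<phi>\<close> vanishes on
    it, so its derivative is zero there and uniqueness of derivatives applies.\<close>
  have z': "\<phi>t p = 0 \<and> \<phi>s p = 0" if p: "p \<notin> C" for p
  proof -
    have "((\<lambda>_. 0) has_derivative (\<lambda>h. \<phi>t p * fst h + \<phi>s p * snd h)) (at p)"
      by (rule has_derivative_transform_within_open[OF test_functionD(1)[OF t], of "- C"])
         (use C p z in \<open>auto simp: compact_imp_closed\<close>)
    from has_derivative_unique[OF this has_derivative_const]
    have e: "\<phi>t p * fst h + \<phi>s p * snd h = 0" for h by (rule fun_cong)
    show ?thesis using e[of "(1, 0)"] e[of "(0, 1)"] by simp
  qed
  have bd: "\<exists>M. \<forall>p. \<bar>h p\<bar> \<le> M" if h: "continuous_on C h" "\<And>p. p \<notin> C \<Longrightarrow> h p = 0" for h :: "real \<times> real \<Rightarrow> real"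
  proof -
    obtain M where M: "\<And>p. p \<in> C \<Longrightarrow> \<bar>h p\<bar> \<le> M"
      using compact_imp_bounded[OF compact_continuous_image[OF h(1) C]] unfolding bounded_iff
      by (metis image_eqI real_norm_def)
    have "\<bar>h p\<bar> \<le> max M 0" for p using M[of p] h(2)[of p] by (cases "p \<in> C") auto
    then show ?thesis by blast
  qed
  obtain M1 M2 M3 where M: "\<And>p. \<bar>\<phi> p\<bar> \<le> M1" "\<And>p. \<bar>\<phi>t p\<bar> \<le> M2" "\<And>p. \<bar>\<phi>s p\<bar> \<le> M3"
    using bd[of \<phi>] bd[of \<phi>t] bd[of \<phi>s] test_functionD(2-4)[OF t] z z' by metis
  obtain R where R: "\<And>p. p \<in> C \<Longrightarrow> norm p \<le> R" using compact_imp_bounded[OF C] by (auto simp: bounded_iff)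
  have out: "(t, s) \<notin> C" if "\<bar>t\<bar> > max 1 R \<or> \<bar>s\<bar> > max 1 R" for t s
  proof
    assume "(t, s) \<in> C"
    from R[OF this] norm_fst_le[of t s] norm_snd_le[of s t] that show False by auto
  qed
  show ?thesis
  proof (rule that[of "max 1 R" "max 0 (max M1 (max M2 M3))"])
    fix t s :: real assume "\<bar>t\<bar> > max 1 R \<or> \<bar>s\<bar> > max 1 R"
    then show "\<phi> (t, s) = 0 \<and> \<phi>t (t, s) = 0 \<and> \<phi>s (t, s) = 0" using z z' out by blast
  next
    fix p
    show "\<bar>\<phi> p\<bar> \<le> max 0 (max M1 (max M2 M3))" "\<bar>\<phi>t p\<bar> \<le> max 0 (max M1 (max M2 M3))" "\<bar>\<phi>s p\<bar> \<le> max 0 (max M1 (max M2 M3))"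
      using M[of p] by linarith+
  qed auto
qed

lemma integral_lborel_reflect_negative:
  fixes f :: "real \<Rightarrow> real"
  shows "(LINT s|lborel. indicator {..<0} s * f (- s)) = (LINT t|lborel. indicator {0..} t * f t)"
proof -
  have "(LINT s|lborel. indicator {..<0} s * f (- s)) = (LINT t|lborel. indicator {..<0} (- t) * f t)"
    using lborel_integral_real_affine[of "-1" "\<lambda>s. indicator {..<0} s * f (- s)" 0] by simp
  also have "\<dots> = (LINT t|lborel. indicator {0..} t * f t)"
    by (rule integral_discrete_difference[of "{0}"]) (auto split: split_indicator)
  finally show ?thesis .
qed

context characteristics
begin

text \<open>The excluded time \<open>\<tau> - x\<close> is where promotion sets in and the factor
  may have a kink.\<close>

lemma survival_derivative:
  assumes "t > max 0 (- x)" "t \<noteq> \<tau> - x"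
  shows "((\<lambda>t. survival t x) has_real_derivative - (\<mu> + k t * indicator {\<tau>..} (t + x)) * survival t x) (at t)"
proof (cases "t < \<tau> - x")
  case True
  have "((\<lambda>t. exp (- (\<mu> * (t - max 0 (- x))))) has_real_derivative - (\<mu> + k t * indicator {\<tau>..} (t + x)) * survival t x) (at t)"
    using assms True by (auto intro!: derivative_eq_intros simp: survival_def)
  then show ?thesis
    by (rule has_field_derivative_transform_within_open[of _ _ _ "{max 0 (- x)<..<\<tau> - x}"])
       (use assms True in \<open>auto simp: survival_def\<close>)
next
  case False
  then have t: "t > \<tau> - x" using assms by simp
  have "((\<lambda>t. exp (- (\<mu> * (t - max 0 (- x)) + (K t - K (max 0 (\<tau> - x)))))) has_real_derivative - (\<mu> + k t * indicator {\<tau>..} (t + x)) * survival t x) (at t)"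
    using assms t by (auto intro!: derivative_eq_intros K simp: survival_def algebra_simps)
  then show ?thesis
    by (rule has_field_derivative_transform_within_open[of _ _ _ "{max (max 0 (- x)) (\<tau> - x)<..}"])
       (use assms t in \<open>auto simp: survival_def\<close>)
qed

lemma survival_entry: "survival (max 0 (- x)) x = 1"
proof -
  have "min (max 0 (- x)) (max 0 (\<tau> - x)) = max 0 (- x)" using \<tau> by auto
  then show ?thesis by (simp add: survival_def)
qed

text \<open>In the coordinates \<open>t\<close> and \<open>x = s - t\<close> the integrand is
  \<open>u x\<close> times the derivative of \<open>survival t x * \<phi> (t, t + x)\<close> along
  the characteristic. After Fubini each characteristic contributes minus its value at entry: the
  initial term for \<open>x \<ge> 0\<close>, the boundary term for \<open>x < 0\<close>.\<close>

lemma solution_weak: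
  assumes test: "test_function \<phi> \<phi>t \<phi>s"
  shows "(LINT t:{0..}|lebesgue. (LINT s:{0..}|lebesgue.
            solution t s * (\<phi>t (t, s) + \<phi>s (t, s) - (\<mu> + k t * indicator {\<tau>..} s) * \<phi> (t, s))))
        + (LINT s:{0..}|lebesgue. u s * \<phi> (0, s))
        + (LINT t:{0..}|lebesgue. b * \<phi> (t, 0)) = 0"
proof -
  obtain R M where R: "R > 0" and M0: "M \<ge> 0" and M: "\<And>p. \<bar>\<phi> p\<bar> \<le> M" "\<And>p. \<bar>\<phi>t p\<bar> \<le> M" "\<And>p. \<bar>\<phi>s p\<bar> \<le> M"
    and supp: "\<And>t s. \<bar>t\<bar> > R \<or> \<bar>s\<bar> > R \<Longrightarrow> \<phi> (t, s) = 0 \<and> \<phi>t (t, s) = 0 \<and> \<phi>s (t, s) = 0"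
    using test_function_support[OF test] by metis
  have [measurable]: "\<phi> \<in> borel_measurable (borel \<Otimes>\<^sub>M borel)" "\<phi>t \<in> borel_measurable (borel \<Otimes>\<^sub>M borel)"
      "\<phi>s \<in> borel_measurable (borel \<Otimes>\<^sub>M borel)"
    by (simp_all add: borel_prod borel_measurable_continuous_onI test_functionD(2-4)[OF test])
  have [measurable]: "k \<in> borel_measurable borel" by (rule borel_measurable_continuous_onI[OF k_continuous])
  define \<psi> where "\<psi> = (\<lambda>t s. \<phi>t (t, s) + \<phi>s (t, s) - (\<mu> + k t * indicator {\<tau>..} s) * \<phi> (t, s))"
  obtain Kb where Kb: "\<And>t. t \<in> {0..R} \<Longrightarrow> \<bar>k t\<bar> \<le> Kb"
    by (rule continuous_on_Icc_bounded[OF continuous_on_subset[OF k_continuous, of "{0..R}"]]) auto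
  have Kb0: "Kb \<ge> 0" using Kb[of 0] R by simp
  define B where "B = 2 * M + (\<mu> + Kb) * M"
  have B0: "B \<ge> 0" using M0 Kb0 \<mu> by (simp add: B_def)
  have \<psi>0: "\<psi> t s = 0" if "t > R" for t s using supp[of t s] that R by (simp add: \<psi>_def)
  have \<psi>B: "\<bar>\<psi> t s\<bar> \<le> B" if "t \<ge> 0" for t s
  proof (cases "t \<le> R")
    case True
    have "\<bar>\<mu> + k t * indicator {\<tau>..} s\<bar> \<le> \<mu> + Kb"
      using Kb[of t] True that \<mu> by (auto split: split_indicator)
    then have "\<bar>(\<mu> + k t * indicator {\<tau>..} s) * \<phi> (t, s)\<bar> \<le> (\<mu> + Kb) * M"
      unfolding abs_mult using M(1)[of "(t, s)"] by (intro mult_mono) auto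
    then show ?thesis unfolding \<psi>_def B_def using M(2)[of "(t, s)"] M(3)[of "(t, s)"] by linarith
  next
    case False
    then show ?thesis using \<psi>0 B0 by simp
  qed
  have [measurable]: "(\<lambda>x. \<psi> (f x) (g x)) \<in> borel_measurable N" if [measurable]: "f \<in> borel_measurable N" "g \<in> borel_measurable N"
    for f g :: "'c \<Rightarrow> real" and N
    unfolding \<psi>_def by measurable
  define H where "H = (\<lambda>t x. indicator {0..} t * (indicator {0..} (t + x) * (u x * survival t x * \<psi> t (t + x))))"
  have Hm: "case_prod H \<in> borel_measurable (lborel \<Otimes>\<^sub>M lborel)"
    unfolding H_def by measurable
  \<comment> \<open>The conditions \<open>t \<le> R\<close> and \<open>t + x \<ge> 0\<close> force
    \<open>x \<ge> - R\<close>, so a product of integrable functions dominates and Fubini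
    applies.\<close>
  have HB: "\<bar>H t x\<bar> \<le> indicator {0..R} t * (B * \<bar>truncated R x\<bar>)" for t x
  proof (cases "0 \<le> t \<and> 0 \<le> t + x \<and> t \<le> R")
    case True
    have "\<bar>u x * (survival t x * \<psi> t (t + x))\<bar> \<le> B * \<bar>u x\<bar>"
    proof (rule abs_mult_le_bound)
      have "\<bar>survival t x * \<psi> t (t + x)\<bar> \<le> 1 * B"
        unfolding abs_mult using survival_bounds[of t x] \<psi>B[of t "t + x"] True by (intro mult_mono) auto
      then show "\<bar>survival t x * \<psi> t (t + x)\<bar> \<le> B" by simp
    qed
    then show ?thesis using True by (simp add: H_def truncated_def mult.assoc)
  next
    case False
    then have "H t x = 0" using \<psi>0[of t] by (auto simp: H_def not_le split: split_indicator)
    then show ?thesis using B0 by simp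
  qed
  have Hi: "integrable (lborel \<Otimes>\<^sub>M lborel) (case_prod H)"
  proof (rule Bochner_Integration.integrable_bound)
    have tb: "integrable lborel (\<lambda>x. B * \<bar>truncated R x\<bar>)" using truncated_integrable by auto
    note [measurable] = borel_measurable_integrable[OF truncated_integrable[of R], simplified]
    show "integrable (lborel \<Otimes>\<^sub>M lborel) (\<lambda>(t, x). indicator {0..R} t * (B * \<bar>truncated R x\<bar>))"
    proof (rule lborel_pair.Fubini_integrable)
      have "integrable lborel (\<lambda>t. indicator {0..R} t * (LINT x|lborel. B * \<bar>truncated R x\<bar>))"
        by (intro integrable_mult_left integrable_real_indicator emeasure_bounded_finite) auto
      moreover have "(LINT x|lborel. norm (case (t, x) of (t, x) \<Rightarrow> indicator {0..R} t * (B * \<bar>truncated R x\<bar>)))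
          = indicator {0..R} t * (LINT x|lborel. B * \<bar>truncated R x\<bar>)" for t
        using B0 by (simp add: abs_mult)
      ultimately show "integrable lborel (\<lambda>t. LINT x|lborel. norm (case (t, x) of (t, x) \<Rightarrow> indicator {0..R} t * (B * \<bar>truncated R x\<bar>)))"
        by simp
      show "AE t in lborel. integrable lborel (\<lambda>x. case (t, x) of (t, x) \<Rightarrow> indicator {0..R} t * (B * \<bar>truncated R x\<bar>))"
        using tb by auto
    qed measurable
    show "AE p in lborel \<Otimes>\<^sub>M lborel. norm (case p of (t, x) \<Rightarrow> H t x) \<le> norm (case p of (t, x) \<Rightarrow> indicator {0..R} t * (B * \<bar>truncated R x\<bar>))"
      using HB B0 by (auto simp: abs_mult)
  qed (rule Hm)
  have inner: "(LINT s:{0..}|lebesgue. solution t s * \<psi> t s)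
     = (LINT x|lborel. indicator {0..} (t + x) * (u x * survival t x * \<psi> t (t + x)))" for t
  proof -
    have "(LINT s:{0..}|lebesgue. solution t s * \<psi> t s) = (LINT s|lborel. indicator {0..} s *\<^sub>R (solution t s * \<psi> t s))"
      unfolding set_lebesgue_integral_def by (rule integral_completion) measurable
    also have "\<dots> = (LINT x|lborel. indicator {0..} (t + x) *\<^sub>R (solution t (t + x) * \<psi> t (t + x)))"
      using lborel_integral_real_affine[of 1 "\<lambda>s. indicator {0..} s *\<^sub>R (solution t s * \<psi> t s)" t] by simp
    finally show ?thesis by (simp add: solution_def)
  qed
  have "(LINT t:{0..}|lebesgue. (LINT s:{0..}|lebesgue. solution t s * \<psi> t s)) = (LINT t|lebesgue. (LINT x|lborel. H t x))"
    unfolding inner by (simp add: set_lebesgue_integral_def H_def)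
  also have "\<dots> = (LINT t|lborel. (LINT x|lborel. H t x))"
    by (rule integral_completion) (use lborel.borel_measurable_lebesgue_integral[OF Hm] in simp)
  also have "\<dots> = (LINT x|lborel. (LINT t|lborel. H t x))"
    by (rule lborel_pair.Fubini_integral[OF Hi, symmetric])
  also have "\<dots> = (LINT x|lborel. - (u x * \<phi> (max 0 (- x), max 0 (- x) + x)))"
  proof (rule Bochner_Integration.integral_cong[OF refl])
    fix x :: real
    define t0 where "t0 = max 0 (- x)"
    \<comment> \<open>Beyond the entry time and strictly beyond the support in \<open>t\<close>, so
      that the upper boundary term vanishes.\<close>
    define R' where "R' = max R t0 + 1"
    have t0R: "t0 \<le> R'" "R < R'" by (auto simp: R'_def)
    let ?q = "\<lambda>t. survival t x * \<phi> (t, t + x)" and ?d = "\<lambda>t. survival t x * \<psi> t (t + x)"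
    have ftc: "(?d has_integral (?q R' - ?q t0)) {t0..R'}"
    \<comment> \<open>Continuity across the kink at \<open>\<tau> - x\<close> suffices; the
      derivative is required only off this point.\<close>
    proof (rule fundamental_theorem_of_calculus_interior_strong[of "{\<tau> - x}"])
      show "continuous_on {t0..R'} ?q"
        by (intro continuous_intros continuous_on_compose2[OF survival_continuous[of UNIV], of _ "\<lambda>t. (t, x)", simplified]
           continuous_on_compose2[OF test_functionD(2)[OF test, of UNIV]]) auto
      fix t assume t: "t \<in> {t0<..<R'} - {\<tau> - x}"
      have "((\<lambda>t. (t, t + x)) has_derivative (\<lambda>h. (h, h))) (at t)"
        by (auto intro!: derivative_eq_intros)
      from has_derivative_compose[OF this test_functionD(1)[OF test]]
      have "((\<lambda>t. \<phi> (t, t + x)) has_real_derivative \<phi>t (t, t + x) + \<phi>s (t, t + x)) (at t)"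
        unfolding has_field_derivative_def by (rule has_derivative_eq_rhs) (simp add: fun_eq_iff algebra_simps)
      from DERIV_mult[OF survival_derivative[of x t] this] t
      have "(?q has_real_derivative ?d t) (at t)"
        by (simp add: t0_def \<psi>_def algebra_simps)
      then show "(?q has_vector_derivative ?d t) (at t)" by (simp add: has_real_derivative_iff_has_vector_derivative)
    qed (use t0R in auto)
    have "\<phi> (R', R' + x) = 0" using supp[of R' "R' + x"] t0R R by simp
    then have I: "integral {t0..R'} ?d = - \<phi> (t0, t0 + x)"
      using integral_unique[OF ftc] survival_entry[of x] by (simp add: t0_def)
    have si: "set_integrable lborel {t0..R'} ?d"
      unfolding set_integrable_def
    proof (rule Bochner_Integration.integrable_bound)
      show "integrable lborel (\<lambda>t. B * indicator {t0..R'} t)"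
        by (intro integrable_mult_right integrable_real_indicator emeasure_bounded_finite) auto
      have "\<bar>?d t\<bar> \<le> 1 * B" if "t \<ge> t0" for t
        unfolding abs_mult using survival_bounds[of t x] \<psi>B[of t "t + x"] that by (intro mult_mono) (auto simp: t0_def)
      then show "AE t in lborel. norm (indicator {t0..R'} t *\<^sub>R ?d t) \<le> norm (B * indicator {t0..R'} t)"
        using B0 by (auto split: split_indicator)
    qed measurable
    have "(LINT t|lborel. H t x) = (LINT t|lborel. u x * (indicator {t0..R'} t *\<^sub>R ?d t))"
    proof (rule Bochner_Integration.integral_cong[OF refl])
      fix t
      show "H t x = u x * (indicator {t0..R'} t *\<^sub>R ?d t)"
        using \<psi>0[of t] t0R by (auto simp: H_def t0_def split: split_indicator)
    qed
    also have "\<dots> = u x * (LINT t:{t0..R'}|lborel. ?d t)" by (simp add: set_lebesgue_integral_def)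
    also have "\<dots> = - (u x * \<phi> (t0, t0 + x))" using set_borel_integral_eq_integral(2)[OF si] I by simp
    finally show "(LINT t|lborel. H t x) = - (u x * \<phi> (max 0 (- x), max 0 (- x) + x))" by (simp add: t0_def)
  qed
  \<comment> \<open>The entry point is \<open>(0, x)\<close> for \<open>x \<ge> 0\<close> and
    \<open>(- x, 0)\<close> for \<open>x < 0\<close>; in the second case
    \<open>u x = b\<close>.\<close>
  also have "\<dots> = - (LINT x|lborel. (indicator {0..} x * (u x * \<phi> (0, x)) + indicator {..<0} x * (b * \<phi> (- x, 0))))"
    by (subst Bochner_Integration.integral_minus[symmetric], rule Bochner_Integration.integral_cong)
       (auto simp: u_negative split: split_indicator)
  also have "(LINT x|lborel. (indicator {0..} x * (u x * \<phi> (0, x)) + indicator {..<0} x * (b * \<phi> (- x, 0))))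
     = (LINT x|lborel. indicator {0..} x * (u x * \<phi> (0, x))) + (LINT x|lborel. indicator {..<0} x * (b * \<phi> (- x, 0)))"
  proof (rule Bochner_Integration.integral_add)
    show "integrable lborel (\<lambda>x. indicator {0..} x * (u x * \<phi> (0, x)))"
    proof (rule Bochner_Integration.integrable_bound)
      show "integrable lborel (\<lambda>x. M * (indicator {0..} x * u x))"
        using u_integrable unfolding set_integrable_def by (intro integrable_mult_right) simp
      have "\<bar>u x * \<phi> (0, x)\<bar> \<le> M * \<bar>u x\<bar>" for x by (rule abs_mult_le_bound[OF M(1)])
      then show "AE x in lborel. norm (indicator {0..} x * (u x * \<phi> (0, x))) \<le> norm (M * (indicator {0..} x * u x))"
        using M0 by (auto simp: abs_mult split: split_indicator)
    qed measurable
    show "integrable lborel (\<lambda>x. indicator {..<0} x * (b * \<phi> (- x, 0)))"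
    proof (rule Bochner_Integration.integrable_bound)
      show "integrable lborel (\<lambda>x. M * \<bar>b\<bar> * indicator {- R..R} x)"
        by (intro integrable_mult_right integrable_real_indicator emeasure_bounded_finite) auto
      have "\<bar>b * \<phi> (- x, 0)\<bar> \<le> M * \<bar>b\<bar>" for x by (rule abs_mult_le_bound[OF M(1)])
      moreover have "\<phi> (- x, 0) = 0" if "x \<notin> {- R..R}" for x using supp[of "- x" 0] that by (auto simp: abs_if)
      ultimately show "AE x in lborel. norm (indicator {..<0} x * (b * \<phi> (- x, 0))) \<le> norm (M * \<bar>b\<bar> * indicator {- R..R} x)"
        using M0 by (auto simp: abs_mult split: split_indicator)
    qed measurable
  qed
  also have "(LINT x|lborel. indicator {..<0} x * (b * \<phi> (- x, 0))) = (LINT t|lborel. indicator {0..} t * (b * \<phi> (t, 0)))"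
    by (rule integral_lborel_reflect_negative)
  also have "(LINT x|lborel. indicator {0..} x * (u x * \<phi> (0, x))) = (LINT s:{0..}|lebesgue. u s * \<phi> (0, s))"
    unfolding set_lebesgue_integral_def real_scaleR_def by (rule integral_completion[symmetric]) measurable
  also have "(LINT t|lborel. indicator {0..} t * (b * \<phi> (t, 0))) = (LINT t:{0..}|lebesgue. b * \<phi> (t, 0))"
    unfolding set_lebesgue_integral_def real_scaleR_def by (rule integral_completion[symmetric]) measurable
  finally show ?thesis unfolding \<psi>_def by simp
qed

end

subsection \<open>Coupling through the eligible mass\<close>

text \<open>This allows a prescribed rate and the coupled rate to be exchanged once they are known
  to agree at nonnegative times.\<close>

lemma weak_solution_rate_cong:
  assumes "\<And>t s. t \<ge> 0 \<Longrightarrow> r t s = r' t s"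
  shows "weak_solution r b f\<^sub>0 f \<longleftrightarrow> weak_solution r' b f\<^sub>0 f"
proof -
  have "(LINT t:{0..}|lebesgue. (LINT s:{0..}|lebesgue. f t s * (\<phi>t (t, s) + \<phi>s (t, s) - r t s * \<phi> (t, s))))
     = (LINT t:{0..}|lebesgue. (LINT s:{0..}|lebesgue. f t s * (\<phi>t (t, s) + \<phi>s (t, s) - r' t s * \<phi> (t, s))))" for \<phi> \<phi>t \<phi>s
    by (rule set_lebesgue_integral_cong) (auto simp: assms)
  then show ?thesis by (simp add: weak_solution_def)
qed

lemma weak_solution_exists:
  assumes \<mu>: "\<mu> > 0" and \<tau>: "\<tau> \<ge> 0" and k: "continuous_on {0..} k" "\<And>t. t \<ge> 0 \<Longrightarrow> k t \<ge> 0"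
    and f0: "f\<^sub>0 absolutely_integrable_on {0..}"
  obtains f where "weak_solution (\<lambda>t s. \<mu> + k t * indicator {\<tau>..} s) b f\<^sub>0 f"
proof -
  \<comment> \<open>A continuous nonnegative extension to negative times, where the rate is not
    prescribed.\<close>
  let ?k = "\<lambda>t. k (max 0 t)"
  have kc: "continuous_on UNIV ?k" by (rule continuous_on_compose2[OF k(1)]) (auto intro!: continuous_intros)
  obtain K where K: "\<And>t. (K has_real_derivative ?k t) (at t)" using antiderivative_real[OF kc] by blast
  let ?F = "\<lambda>s. indicator {0..} s * f\<^sub>0 s"
  have F: "integrable lebesgue ?F" using f0 by (simp add: set_integrable_def)
  \<comment> \<open>The construction composes the data with translations and uses Fubini for Borel
    measure, so the datum is replaced by a Borel representative.\<close>
  from completion_ex_borel_measurable_real[OF borel_measurable_integrable[OF F]]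
  obtain v where v: "v \<in> borel_measurable lborel" and ae: "AE s in lborel. ?F s = v s" by (elim bexE)
  define u where "u x = (if x < 0 then b else v x)" for x
  have um: "u \<in> borel_measurable borel" unfolding u_def[abs_def] using v by measurable
  have ae': "AE s in lebesgue. s \<ge> 0 \<longrightarrow> u s = f\<^sub>0 s"
    using AE_completion[OF ae] by eventually_elim (auto simp: u_def)
  have "integrable lborel v"
    using integrable_cong_AE_imp[OF F measurable_completion[OF v] AE_completion[OF ae]] v by (simp add: integrable_completion)
  then have "integrable lborel (\<lambda>x. indicator {0..} x *\<^sub>R v x)" by (intro integrable_mult_indicator) auto
  also have "(\<lambda>x. indicator {0..} x *\<^sub>R v x) = (\<lambda>x. indicator {0..} x *\<^sub>R u x)"
    by (auto simp: u_def fun_eq_iff split: split_indicator)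
  finally have ui: "set_integrable lborel {0..} u" by (simp add: set_integrable_def)
  interpret characteristics \<mu> \<tau> b ?k K u
    by unfold_locales (use \<mu> \<tau> kc k(2) K um ui in \<open>auto simp: u_def\<close>)
  have "eq_L1 (solution 0) f\<^sub>0"
    unfolding eq_L1_def using ae'
  proof eventually_elim
    case (elim s)
    show ?case using elim survival_entry[of s] by (auto simp: solution_def)
  qed
  moreover have "(LINT s:{0..}|lebesgue. f\<^sub>0 s * \<phi> (0, s)) = (LINT s:{0..}|lebesgue. u s * \<phi> (0, s))"
    if "test_function \<phi> \<phi>t \<phi>s" for \<phi> \<phi>t \<phi>s
    unfolding set_lebesgue_integral_def
  proof (rule integral_cong_AE)
    have \<phi>m: "(\<lambda>s. \<phi> (0, s)) \<in> borel_measurable borel"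
      by (rule borel_measurable_continuous_onI, rule continuous_on_compose2[OF test_functionD(2)[OF that, of UNIV]])
         (auto intro!: continuous_intros)
    have "(\<lambda>s. ?F s * \<phi> (0, s)) \<in> borel_measurable lebesgue"
      by (rule borel_measurable_times[OF borel_measurable_integrable[OF F] shift_measurable_lebesgue(3)[OF \<phi>m]])
    then show "(\<lambda>s. indicator {0..} s *\<^sub>R (f\<^sub>0 s * \<phi> (0, s))) \<in> borel_measurable lebesgue" by (simp add: mult.assoc)
    have "(\<lambda>s. indicator {0..} s *\<^sub>R (u s * \<phi> (0, s))) \<in> borel_measurable lborel"
      using um \<phi>m by measurable
    then show "(\<lambda>s. indicator {0..} s *\<^sub>R (u s * \<phi> (0, s))) \<in> borel_measurable lebesgue" by (rule measurable_completion)
    show "AE s in lebesgue. indicator {0..} s *\<^sub>R (f\<^sub>0 s * \<phi> (0, s)) = indicator {0..} s *\<^sub>R (u s * \<phi> (0, s))"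
      using ae' by eventually_elim (auto split: split_indicator)
  qed
  ultimately have "weak_solution (\<lambda>t s. \<mu> + ?k t * indicator {\<tau>..} s) b f\<^sub>0 solution"
    unfolding weak_solution_def using solution_continuous_L1 solution_weak by simp
  then have "weak_solution (\<lambda>t s. \<mu> + k t * indicator {\<tau>..} s) b f\<^sub>0 solution"
    by (rule weak_solution_rate_cong[THEN iffD1, rotated]) simp
  then show ?thesis by (rule that)
qed

lemma set_integral_split_at:
  fixes h :: "real \<Rightarrow> real"
  assumes "h absolutely_integrable_on {0..}" "\<tau> \<ge> 0"
  shows "(LINT s:{0..}|lebesgue. h s) = (LINT s:{0..\<tau>}|lebesgue. h s) + (LINT s:{\<tau>..}|lebesgue. h s)"
proof -
  have "(LINT s:{0..\<tau>} \<union> {\<tau>..}|lebesgue. h s) = (LINT s:{0..\<tau>}|lebesgue. h s) + (LINT s:{\<tau>..}|lebesgue. h s)"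
  proof (rule set_integral_Un_AE)
    show "AE s in lebesgue. \<not> (s \<in> {0..\<tau>} \<and> s \<in> {\<tau>..})"
      using AE_lebesgue_neq[of \<tau>] by eventually_elim auto
    show "h absolutely_integrable_on {0..\<tau>}" "h absolutely_integrable_on {\<tau>..}"
      by (rule set_integrable_subset[OF assms(1)], use assms(2) in auto)+
  qed auto
  moreover have "{0..\<tau>} \<union> {\<tau>..} = {0..}" using assms(2) by auto
  ultimately show ?thesis by simp
qed

text \<open>One class: its eligible mass is known in advance, as total mass minus the mass below the threshold.\<close>

locale job_class =
  fixes \<mu> \<tau> N C :: real and f\<^sub>0 :: "real \<Rightarrow> real"
  assumes \<mu>: "\<mu> > 0" and \<tau>: "\<tau> \<ge> 0" and C: "C \<ge> 0"
    and f0_integrable: "f\<^sub>0 absolutely_integrable_on {0..}" and f0_mass: "(LINT s:{0..}|lebesgue. f\<^sub>0 s) = N"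
    and initially_eligible: "\<And>t. t \<in> {0..\<tau>} \<Longrightarrow> exp (- t * \<mu>) * (LINT s:{t..\<tau>}|lebesgue. f\<^sub>0 (s - t))
           + 1 / \<mu> * (1 - exp (- \<mu> * t)) * (\<mu> * N + C) < N"
    and finally_eligible: "(\<mu> * N * exp (- \<mu> * \<tau>) - (1 - exp (- \<mu> * \<tau>)) * C) / \<mu> > 0"
begin

text \<open>This is \<open>N\<close> minus the formula of \<open>mass_below_threshold\<close> for
  \<open>q = \<tau>\<close> and \<open>b = \<mu> * N + C\<close>.\<close>

definition eligible :: "real \<Rightarrow> real" where
  "eligible t = N - ((\<mu> * N + C) / \<mu> + ((LINT s:{0..\<tau> - t}|lebesgue. f\<^sub>0 s) - (\<mu> * N + C) / \<mu>) * exp (- (\<mu> * min t \<tau>)))"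

text \<open>From time \<open>\<tau>\<close> on, no member of the initial population is still below
  the threshold, so the initial data drop out.\<close>

lemma eligible_late:
  assumes "t \<ge> \<tau>"
  shows "eligible t = (\<mu> * N * exp (- \<mu> * \<tau>) - (1 - exp (- \<mu> * \<tau>)) * C) / \<mu>"
proof -
  have "(LINT s:{0..\<tau> - t}|lebesgue. f\<^sub>0 s) = 0"
  proof (rule set_integral_null)
    show "AE s in lebesgue. s \<in> {0..\<tau> - t} \<longrightarrow> f\<^sub>0 s = 0"
      using AE_lebesgue_neq[of 0] by eventually_elim (use assms in auto)
  qed
  then show ?thesis using assms \<mu> by (simp add: eligible_def min_def field_simps)
qed

text \<open>Each of the two eligibility hypotheses covers one range of times: the first is the claim
  for \<open>t \<le> \<tau>\<close> after translating the integral, the second is the constant value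
  afterwards.\<close>

lemma eligible_pos:
  assumes "t \<ge> 0"
  shows "eligible t > 0"
proof (cases "t \<le> \<tau>")
  case True
  have "(LINT s:{t..\<tau>}|lebesgue. f\<^sub>0 (s - t)) = (LINT x|lebesgue. indicator {t..\<tau>} (t + 1 * x) *\<^sub>R f\<^sub>0 (t + 1 * x - t))"
    unfolding set_lebesgue_integral_def
    using lebesgue_integral_real_affine[of 1 "\<lambda>s. indicator {t..\<tau>} s *\<^sub>R f\<^sub>0 (s - t)" t] by simp
  also have "\<dots> = (LINT s:{0..\<tau> - t}|lebesgue. f\<^sub>0 s)"
    unfolding set_lebesgue_integral_def
    by (rule Bochner_Integration.integral_cong) (auto split: split_indicator)
  finally have "(LINT s:{t..\<tau>}|lebesgue. f\<^sub>0 (s - t)) = (LINT s:{0..\<tau> - t}|lebesgue. f\<^sub>0 s)" .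
  moreover have "b / \<mu> + (I - b / \<mu>) * e = e * I + 1 / \<mu> * (1 - e) * b" for b I e
    using \<mu> by (simp add: field_simps)
  ultimately show ?thesis using initially_eligible[of t] True assms
    by (simp add: eligible_def min_def mult.commute[of t \<mu>] del: times_divide_eq_left)
next
  case False
  then show ?thesis using eligible_late[of t] finally_eligible by simp
qed

text \<open>The rate is arbitrary and the total mass is left open, so the identity is available
  before conservation of mass is known.\<close>

lemma mass_above_threshold:
  assumes "weak_solution (\<lambda>t s. \<mu> + k t * indicator {\<tau>..} s) (\<mu> * N + C) f\<^sub>0 f" "continuous_on {0..} k" "t \<ge> 0"
  shows "(LINT s:{\<tau>..}|lebesgue. f t s) = (LINT s:{0..}|lebesgue. f t s) - N + eligible t"
proof -
  have f: "continuous_L1 f" using assms(1) by (simp add: weak_solution_def)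
  show ?thesis
    using mass_below_threshold[OF assms(1) \<tau> assms(2) f0_integrable assms(3) \<tau> order.refl \<mu>]
      set_integral_split_at[OF continuous_L1_integrable[OF f assms(3) order.refl] \<tau>]
    by (simp add: eligible_def)
qed

text \<open>The formula does not involve the rate, so it can be read off from a solution with zero
  promotion rate, whose masses are continuous in time.\<close>

lemma eligible_continuous: "continuous_on {0..} eligible"
proof -
  obtain f where w: "weak_solution (\<lambda>t s. \<mu> + (\<lambda>_. 0) t * indicator {\<tau>..} s) (\<mu> * N + C) f\<^sub>0 f"
    using weak_solution_exists[OF \<mu> \<tau> _ _ f0_integrable, of "\<lambda>_. 0"] by auto
  have f: "continuous_L1 f" using w by (simp add: weak_solution_def)
  have p: "continuous_on {0..} (transport_pairing f a (\<lambda>_. 1))" if "a \<ge> 0" for a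
    by (rule transport_pairing_continuous[OF f that, of _ 1 "{}"]) auto
  have "continuous_on {0..} (\<lambda>t. transport_pairing f \<tau> (\<lambda>_. 1) t - transport_pairing f 0 (\<lambda>_. 1) t + N)"
    by (intro continuous_intros p \<tau> order.refl)
  then show ?thesis
    by (rule continuous_on_eq) (use mass_above_threshold[OF w] in \<open>simp add: transport_pairing_def\<close>)
qed

text \<open>Positivity makes the coupled rate continuous and the promoted flux equal to
  \<open>C\<close>. The total mass is then \<open>N\<close>, and the balance across the threshold
  fixes the eligible mass.\<close>

lemma mass_above_threshold_eq_eligible:
  assumes w: "weak_solution (\<lambda>t s. \<mu> + C / (LINT s:{\<tau>..}|lebesgue. f t s) * indicator {\<tau>..} s) (\<mu> * N + C) f\<^sub>0 f"
    and pos: "\<And>t. t \<ge> 0 \<Longrightarrow> (LINT s:{\<tau>..}|lebesgue. f t s) > 0"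
  shows "continuous_on {0..} (\<lambda>t. C / (LINT s:{\<tau>..}|lebesgue. f t s))" (is "continuous_on _ ?k")
    and "\<And>t. t \<ge> 0 \<Longrightarrow> (LINT s:{\<tau>..}|lebesgue. f t s) = eligible t"
proof -
  have f: "continuous_L1 f" using w by (simp add: weak_solution_def)
  have "continuous_on {0..} (transport_pairing f \<tau> (\<lambda>_. 1))"
    by (rule transport_pairing_continuous[OF f \<tau>, of _ 1 "{}"]) auto
  then have "continuous_on {0..} (\<lambda>t. LINT s:{\<tau>..}|lebesgue. f t s)" by (simp add: transport_pairing_def[abs_def])
  then show k: "continuous_on {0..} ?k"
    by (intro continuous_intros) (use pos in force)+
  fix t :: real assume t: "t \<ge> 0"
  have "(LINT s:{0..}|lebesgue. f t s) = N"
  proof (rule mass_conservation[OF w \<tau> k f0_integrable f0_mass _ _ t])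
    show "?k t * (LINT s:{\<tau>..}|lebesgue. f t s) = C + (\<lambda>_. 0) t * ((LINT s:{0..}|lebesgue. f t s) - N)" if "t \<ge> 0" for t
      using pos[OF that] by simp
  qed simp
  then show "(LINT s:{\<tau>..}|lebesgue. f t s) = eligible t" using mass_above_threshold[OF w k t] by simp
qed

lemma exists_class_solution:
  obtains f where "weak_solution (\<lambda>t s. \<mu> + C / (LINT s:{\<tau>..}|lebesgue. f t s) * indicator {\<tau>..} s) (\<mu> * N + C) f\<^sub>0 f"
    "\<And>t. t \<ge> 0 \<Longrightarrow> (LINT s:{\<tau>..}|lebesgue. f t s) > 0"
proof -
  let ?k = "\<lambda>t. C / eligible t"
  have k: "continuous_on {0..} ?k"
    by (intro continuous_intros eligible_continuous) (use eligible_pos in force)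
  obtain f where w: "weak_solution (\<lambda>t s. \<mu> + ?k t * indicator {\<tau>..} s) (\<mu> * N + C) f\<^sub>0 f"
    by (rule weak_solution_exists[OF \<mu> \<tau> k _ f0_integrable]) (use eligible_pos C in \<open>simp add: less_imp_le\<close>)
  have A: "(LINT s:{\<tau>..}|lebesgue. f t s) = eligible t" if t: "t \<ge> 0" for t
  proof -
    have "(LINT s:{0..}|lebesgue. f t s) = N"
    proof (rule mass_conservation[OF w \<tau> k f0_integrable f0_mass _ k t])
      show "?k t * (LINT s:{\<tau>..}|lebesgue. f t s) = C + ?k t * ((LINT s:{0..}|lebesgue. f t s) - N)" if "t \<ge> 0" for t
        unfolding mass_above_threshold[OF w k that] using eligible_pos[OF that] by (simp add: field_simps)
    qed
    then show ?thesis using mass_above_threshold[OF w k t] by simp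
  qed
  show ?thesis
  proof (rule that)
    show "weak_solution (\<lambda>t s. \<mu> + C / (LINT s:{\<tau>..}|lebesgue. f t s) * indicator {\<tau>..} s) (\<mu> * N + C) f\<^sub>0 f"
      using w by (rule weak_solution_rate_cong[THEN iffD1, rotated]) (simp add: A)
  qed (simp add: A eligible_pos)
qed

text \<open>Both coupled rates equal \<open>C / eligible\<close>, so the nonlinear comparison
  reduces to uniqueness for one prescribed rate.\<close>

lemma class_solution_unique:
  assumes w: "weak_solution (\<lambda>t s. \<mu> + C / (LINT s:{\<tau>..}|lebesgue. f t s) * indicator {\<tau>..} s) (\<mu> * N + C) f\<^sub>0 f"
    and pos: "\<And>t. t \<ge> 0 \<Longrightarrow> (LINT s:{\<tau>..}|lebesgue. f t s) > 0"
    and w': "weak_solution (\<lambda>t s. \<mu> + C / (LINT s:{\<tau>..}|lebesgue. f' t s) * indicator {\<tau>..} s) (\<mu> * N + C) f\<^sub>0 f'"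
    and pos': "\<And>t. t \<ge> 0 \<Longrightarrow> (LINT s:{\<tau>..}|lebesgue. f' t s) > 0" and t: "t \<ge> 0"
  shows "eq_L1 (f t) (f' t)"
proof (rule weak_solution_unique[OF w _ \<tau> mass_above_threshold_eq_eligible(1)[OF w pos] f0_integrable \<mu> t])
  show "weak_solution (\<lambda>t s. \<mu> + C / (LINT s:{\<tau>..}|lebesgue. f t s) * indicator {\<tau>..} s) (\<mu> * N + C) f\<^sub>0 f'"
    using w' by (rule weak_solution_rate_cong[THEN iffD1, rotated])
      (simp add: mass_above_threshold_eq_eligible(2)[OF w pos] mass_above_threshold_eq_eligible(2)[OF w' pos'])
qed

end

section \<open>Assembly of the levels\<close>

lemma C_const_nonneg:
  assumes "\<And>l. l \<in> {j..L} \<Longrightarrow> N l > 0" "\<And>l. l \<in> {j..L} \<Longrightarrow> \<mu> l > 0" "\<And>l. l \<in> {j..L} \<Longrightarrow> \<alpha> l \<ge> 1"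
  shows "C_const L N \<mu> \<alpha> j \<ge> 0"
  unfolding C_const_def
proof (intro sum_nonneg mult_nonneg_nonneg prod_nonneg)
  fix l k assume "l \<in> {j..L}" "k \<in> {j..l}"
  then have "\<alpha> k \<ge> 1" by (intro assms(3)) auto
  then show "0 \<le> 1 / \<alpha> k" by simp
qed (use assms in \<open>auto intro: less_imp_le\<close>)

theorem proposition2p4:
  fixes L :: nat
    and N \<mu> \<tau> \<alpha> :: "nat \<Rightarrow> real"
    and \<rho>\<^sub>0 :: "nat \<Rightarrow> real \<Rightarrow> real"
  assumes "L \<ge> 2"
    and "\<forall>j\<in>{1..L}. N j > 0"
    and "\<forall>j\<in>{1..L}. \<mu> j > 0"
    and "\<forall>j\<in>{1..L}. \<tau> j \<ge> 0"
    and "\<forall>j\<in>{1..L}. \<alpha> j \<ge> 1"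
    and "\<forall>j\<in>{1..L}. set_integrable lebesgue {0..} (\<rho>\<^sub>0 j)"
    and "\<forall>j\<in>{1..L}. AE s in lebesgue. s \<ge> 0 \<longrightarrow> \<rho>\<^sub>0 j s > 0"
    and "\<forall>j\<in>{1..L}. (LINT s:{0..}|lebesgue. \<rho>\<^sub>0 j s) = N j"
    and "\<forall>j\<in>{1..L}. \<forall>t\<in>{0..\<tau> j}.
           exp (- t * \<mu> j) * (LINT s:{t..\<tau> j}|lebesgue. \<rho>\<^sub>0 j (s - t))
           + 1 / \<mu> j * (1 - exp (- \<mu> j * t)) * (\<mu> j * N j + C_const L N \<mu> \<alpha> (j + 1)) < N j"
    and "\<forall>j\<in>{1..L-1}. A_tilde L N \<mu> \<tau> \<alpha> j > 0"
  shows "well_posed L N \<mu> \<tau> \<alpha> \<rho>\<^sub>0 \<and>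
    (\<forall>\<rho>. system_solution L N \<mu> \<tau> \<alpha> \<rho>\<^sub>0 \<rho> \<longrightarrow>
      (\<forall>j\<in>{1..L-1}.
        (\<forall>t\<ge>0. A_fun \<tau> \<rho> j t > 0) \<and>
        (\<forall>t\<ge>\<tau> j. A_fun \<tau> \<rho> j t = A_tilde L N \<mu> \<tau> \<alpha> j)))"
proof -
  let ?C = "\<lambda>j. C_const L N \<mu> \<alpha> (j + 1)"
  \<comment> \<open>The constants \<open>?C j\<close> depend on the parameters only, so the levels
    decouple and each one can be treated by itself.\<close>
  have cls: "job_class (\<mu> j) (\<tau> j) (N j) (?C j) (\<rho>\<^sub>0 j)" if j: "j \<in> {1..L-1}" for j
  proof
    have jL: "j \<in> {1..L}" using j by auto
    show "\<mu> j > 0" "\<tau> j \<ge> 0" "\<rho>\<^sub>0 j absolutely_integrable_on {0..}" "(LINT s:{0..}|lebesgue. \<rho>\<^sub>0 j s) = N j"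
      using assms(3,4,6,8) jL by blast+
    show "?C j \<ge> 0" by (rule C_const_nonneg) (use assms(2,3,5) in auto)
    show "exp (- t * \<mu> j) * (LINT s:{t..\<tau> j}|lebesgue. \<rho>\<^sub>0 j (s - t))
           + 1 / \<mu> j * (1 - exp (- \<mu> j * t)) * (\<mu> j * N j + ?C j) < N j" if "t \<in> {0..\<tau> j}" for t
      using assms(9) jL that by blast
    show "(\<mu> j * N j * exp (- \<mu> j * \<tau> j) - (1 - exp (- \<mu> j * \<tau> j)) * ?C j) / \<mu> j > 0"
      using assms(10) j unfolding A_tilde_def by blast
  qed
  have LL: "L \<in> {1..L}" and LL': "L \<notin> {1..L-1}" using assms(1) by auto
  have top: "\<mu> L > 0" "\<tau> L \<ge> 0" "\<rho>\<^sub>0 L absolutely_integrable_on {0..}" using assms(3,4,6) LL by blast+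
  have lower: "(\<forall>t\<ge>0. (LINT s:{\<tau> j..}|lebesgue. \<rho> j t s) > 0) \<and>
      weak_solution (\<lambda>t s. \<mu> j + ?C j / (LINT s:{\<tau> j..}|lebesgue. \<rho> j t s) * indicator {\<tau> j..} s) (\<mu> j * N j + ?C j) (\<rho>\<^sub>0 j) (\<rho> j)"
    if "system_solution L N \<mu> \<tau> \<alpha> \<rho>\<^sub>0 \<rho>" "j \<in> {1..L-1}" for \<rho> j
    using that unfolding system_solution_def A_fun_def by blast
  have "\<exists>\<rho>. system_solution L N \<mu> \<tau> \<alpha> \<rho>\<^sub>0 \<rho>"
  proof -
    \<comment> \<open>Nobody is promoted out of the top level, so it fits the general form with zero
      promotion rate.\<close>
    obtain fL where fL: "weak_solution (\<lambda>t s. \<mu> L + (\<lambda>_. 0) t * indicator {\<tau> L..} s) (\<mu> L * N L) (\<rho>\<^sub>0 L) fL"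
      using weak_solution_exists[OF top(1,2) _ _ top(3), of "\<lambda>_. 0"] by auto
    have "\<forall>j\<in>{1..L-1}. \<exists>f. weak_solution (\<lambda>t s. \<mu> j + ?C j / (LINT s:{\<tau> j..}|lebesgue. f t s) * indicator {\<tau> j..} s)
        (\<mu> j * N j + ?C j) (\<rho>\<^sub>0 j) f \<and> (\<forall>t\<ge>0. (LINT s:{\<tau> j..}|lebesgue. f t s) > 0)"
      using job_class.exists_class_solution[OF cls] by metis
    from bchoice[OF this]
    obtain F where F: "\<forall>j\<in>{1..L-1}. weak_solution (\<lambda>t s. \<mu> j + ?C j / (LINT s:{\<tau> j..}|lebesgue. F j t s) * indicator {\<tau> j..} s)
        (\<mu> j * N j + ?C j) (\<rho>\<^sub>0 j) (F j) \<and> (\<forall>t\<ge>0. (LINT s:{\<tau> j..}|lebesgue. F j t s) > 0)"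
      by (elim exE)
    have "system_solution L N \<mu> \<tau> \<alpha> \<rho>\<^sub>0 (\<lambda>j. if j = L then fL else F j)"
      unfolding system_solution_def A_fun_def
    proof (intro conjI ballI)
      fix j assume j: "j \<in> {1..L-1}"
      then have "j \<noteq> L" using LL' by blast
      then show "\<forall>t\<ge>0. 0 < (LINT s:{\<tau> j..}|lebesgue. (if j = L then fL else F j) t s)"
        "weak_solution (\<lambda>t s. \<mu> j + ?C j / (LINT s:{\<tau> j..}|lebesgue. (if j = L then fL else F j) t s) * indicator {\<tau> j..} s)
          (\<mu> j * N j + ?C j) (\<rho>\<^sub>0 j) (if j = L then fL else F j)"
        using bspec[OF F j] by simp_all
    qed (use fL in simp)
    then show ?thesis by blast
  qed
  moreover have "eq_L1 (\<rho> j t) (\<rho>' j t)"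
    if s: "system_solution L N \<mu> \<tau> \<alpha> \<rho>\<^sub>0 \<rho>" "system_solution L N \<mu> \<tau> \<alpha> \<rho>\<^sub>0 \<rho>'" and j: "j \<in> {1..L}" and t: "t \<ge> 0" for \<rho> \<rho>' j t
  proof (cases "j = L")
    case True
    have "weak_solution (\<lambda>t s. \<mu> L + (\<lambda>_. 0) t * indicator {\<tau> L..} s) (\<mu> L * N L) (\<rho>\<^sub>0 L) (\<rho> L)"
      "weak_solution (\<lambda>t s. \<mu> L + (\<lambda>_. 0) t * indicator {\<tau> L..} s) (\<mu> L * N L) (\<rho>\<^sub>0 L) (\<rho>' L)"
      using s by (simp_all add: system_solution_def)
    from weak_solution_unique[OF this top(2) _ top(3,1) t] show ?thesis using True by simp
  next
    case False
    then have "j \<in> {1..L-1}" using j by auto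
    with lower[OF s(1)] lower[OF s(2)] show ?thesis
      by (intro job_class.class_solution_unique[OF cls _ _ _ _ t]) blast+
  qed
  ultimately have "well_posed L N \<mu> \<tau> \<alpha> \<rho>\<^sub>0" unfolding well_posed_def by blast
  moreover have "A_fun \<tau> \<rho> j t > 0" if "system_solution L N \<mu> \<tau> \<alpha> \<rho>\<^sub>0 \<rho>" "j \<in> {1..L-1}" "t \<ge> 0" for \<rho> j t
    using lower[OF that(1,2)] that(3) by (simp add: A_fun_def)
  moreover have "A_fun \<tau> \<rho> j t = A_tilde L N \<mu> \<tau> \<alpha> j"
    if s: "system_solution L N \<mu> \<tau> \<alpha> \<rho>\<^sub>0 \<rho>" and j: "j \<in> {1..L-1}" and t: "t \<ge> \<tau> j" for \<rho> j t
  proof -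
    interpret job_class "\<mu> j" "\<tau> j" "N j" "?C j" "\<rho>\<^sub>0 j" by (rule cls[OF j])
    have "A_fun \<tau> \<rho> j t = eligible t"
      using mass_above_threshold_eq_eligible(2)[of "\<rho> j" t] lower[OF s j] t \<tau> by (simp add: A_fun_def)
    then show ?thesis using eligible_late[OF t] by (simp add: A_tilde_def)
  qed
  ultimately show ?thesis by blast
qed

end
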